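(* Let $\alpha$ be a formula of quantum team logic $\mathrm{QTL}$. Then $\vdash \alpha$ if and only if $\models \alpha$; that is, $\alpha$ is provable in the deductive system of $\mathrm{QTL}$ if and only if $X \models \alpha$ for every quantum team $X$ with $\mathrm{Sp}(\alpha) \leq \mathrm{Sp}(X)$.
   Context: **Propositional formulas.** Proposition symbols are $p_0, p_1, \ldots$. Propositional formulas $\phi,\psi$ are built from proposition symbols with $\neg,\wedge,\vee$; $\mathrm{Var}(\phi)$ is the set of proposition symbols occurring in $\phi$. We write $\phi\equiv\psi$ for classical propositional equivalence. **Comparing families of sets.** For families $\mathcal{U},\mathcal{U}'$ of sets, $\mathcal{U}\leq\mathcal{U}'$ means that for every $U\in\mathcal{U}$ there is $U'\in\mathcal{U}'$ with $U\subseteq U'$. **Quantum teams.** Let $\Omega$ be a finite set and $(Q_i)_{i\in\Omega}$ a sequence of finite non-empty sets of proposition symbols. A quantum team on $(Q_i)_{i\in\Omega}$ is a pair $X=(\Omega,\tau)$ such that, for each $i\in\Omega$, $\tau(i)$ is a truth-value assignment to the proposition symbols in $Q_i$. Its support is $\mathrm{Sp}(X)=\{Q_i : i\in\Omega\}$. For a finite set $U$ of proposition symbols let $\Omega_U=\{i\in\Omega : U\subseteq Q_i\}$. If $\Omega_U\neq\emptyset$ and $\mathrm{Var}(\phi)\subseteq U$, let $$[\phi]_{X,U}=\frac{|\{i\in\Omega_U : \tau(i)(\phi)=1\}|}{|\Omega_U|},$$ where $\tau(i)(\phi)$ is the truth value of $\phi$ under $\tau(i)$. **Syntax of QTL.**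 Atomic formulas are the expressions $\sum_{j<k}a_j(\phi_j;V_j)\geq c$ with $a_j,c\in\mathbb{Z}$, $\phi_j$ propositional formulas, and $V_j$ finite sets of proposition symbols with $\mathrm{Var}(\phi_j)\subseteq V_j$. Formulas are closed under $\neg$ and $\wedge$; $\vee,\rightarrow$ are defined from these as usual. The support $\mathrm{Sp}(\alpha)$ of a formula $\alpha$ is the set of all sets $V_j$ occurring in its atomic subformulas. Abbreviations: for $t=\sum_j a_j(\phi_j;V_j)$, $t\leq c$ is $\sum_j(-a_j)(\phi_j;V_j)\geq -c$; $t<c$ is $\neg(t\geq c)$; $t>c$ is $\neg(t\leq c)$; $t=c$ is $(t\geq c)\wedge(t\leq c)$; $t\geq t'$ is $t-t'\geq 0$, and $t=t'$ is $(t\geq t')\wedge(t\leq t')$. When all supports in a formula are the same set $V$ it is written once, e.g. $(\phi\geq\psi;V)$ is $(\phi;V)-(\psi;V)\geq0$. **Semantics of QTL.** For a quantum team $X$ with $\mathrm{Sp}(\alpha)\leq\mathrm{Sp}(X)$: $X\models\sum_{j<k}a_j(\phi_j;V_j)\geq c$ iff $\sum_{j<k}a_j[\phi_j]_{X,V_j}\geq c$; $X\models\neg\alpha$ iff $X\not\models\alpha$; $X\models\alpha\wedge\beta$ iff $X\models\alpha$ and $X\models\beta$. $\models\alpha$ (validity) means $X\models\alpha$ for every quantum team $X$ with $\mathrm{Sp}(\alpha)\leq\mathrm{Sp}(X)$. **Deductive system of QTL.** The system is parametrized by finite sets $\mathcal{V}$ of non-empty finite sets of proposition symbols. For each such $\mathcal{V}$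 it has the following $\mathcal{V}$-axioms and $\mathcal{V}$-rules, where every formula involved has support $\leq\mathcal{V}$. Below, "$\vdash_{\mathcal V}\alpha \Rightarrow\ \vdash_{\mathcal V}\beta$" is a rule (from $\alpha$ infer $\beta$), and "$\Leftrightarrow$" gives the rule in both directions. Propositional reasoning: - (A) $\vdash_{\mathcal V}\alpha$, for $\alpha$ a propositional tautology. - (B) If $\vdash_{\mathcal V}\alpha\rightarrow\beta$ and $\vdash_{\mathcal V}\alpha$, then $\vdash_{\mathcal V}\beta$ (modus ponens). Probabilistic reasoning: - (C) $\vdash_{\mathcal V}(\phi;V)\geq0$. - (D) $\vdash_{\mathcal V}(\phi\vee\neg\phi;V)=1$. - (E) $\vdash_{\mathcal V}(\phi\wedge\psi+\phi\wedge\neg\psi=\phi;V)$ (additivity). - (F) If $\phi\equiv\psi$ in propositional logic, then $\vdash_{\mathcal V}(\phi=\psi;V)$. Linear inequalities: - (G) $\vdash_{\mathcal V}(\phi\geq\phi;V)$. - (H) $\vdash_{\mathcal V}\sum_{j<k}a_j(\phi_j;V_j)\geq c\ \Leftrightarrow\ \vdash_{\mathcal V}\sum_{j<k}a_j(\phi_j;V_j)+0(\psi;V)\geq c$. - (I) $\vdash_{\mathcal V}\sum_{j<k}a_j(\phi_j;V_j)\geq c\ \Leftrightarrow\ \vdash_{\mathcal V}\sum_{j<k}a_{\sigma(j)}(\phi_{\sigma(j)};V_{\sigma(j)})\geq c$, for $\sigma$ a permutation of $k$. - (J) $\vdash_{\mathcal V}\sum_{j<k}a_j(\phi_j;V_j)\geq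 c\ \wedge\ \sum_{j<k}b_j(\phi_j;V_j)\geq d\ \Rightarrow\ \vdash_{\mathcal V}\sum_{j<k}(a_j+b_j)(\phi_j;V_j)\geq c+d$. - (K) $\vdash_{\mathcal V}\sum_{j<k}a_j(\phi_j;V_j)\geq c\ \Leftrightarrow\ \vdash_{\mathcal V}\sum_{j<k}da_j(\phi_j;V_j)\geq dc$, for $d>0$. - (L) $\vdash_{\mathcal V}\sum_{j<k}a_j(\phi_j;V_j)\geq c\ \vee\ \sum_{j<k}a_j(\phi_j;V_j)\leq c$. - (M) $\vdash_{\mathcal V}\sum_{j<k}a_j(\phi_j;V_j)\geq c\ \Rightarrow\ \vdash_{\mathcal V}\sum_{j<k}a_j(\phi_j;V_j)>d$, for $c>d$. Change of support: - (N) $\vdash_{\mathcal V}(\phi;V)=0$ and $V\subseteq V'\in\mathcal{V}$ $\Rightarrow$ $\vdash_{\mathcal V}(\phi;V')=0$. - (O) $\vdash_{\mathcal V}(\phi;V)=1$ and $V\subseteq V'\in\mathcal{V}$ $\Rightarrow$ $\vdash_{\mathcal V}(\phi;V')=1$. A $\mathcal{V}$-deduction is a sequence of formulas $(\alpha_0,\ldots,\alpha_{n-1})$ such that $\mathrm{Sp}(\alpha_i)\leq\mathcal{V}$ for every $i<n$ and each $\alpha_i$ is either an instance of a $\mathcal{V}$-axiom or follows from one or more of $\alpha_0,\ldots,\alpha_{i-1}$ by one of the $\mathcal{V}$-rules. $\alpha$ is provable, $\vdash\alpha$, if there is an $\mathrm{Sp}(\alpha)$-deduction $(\alpha_0,\ldots,\alpha_{n-1})$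 with $\alpha=\alpha_{n-1}$.
   Formalization: Rules (H)–(O) may also be used under a hypothesis (from γ→α infer γ→β); if they act on theorems only, the valid formula (p;V)−(q;V)≥1 → (p;V)−(q;V)≥0 with V={p,q} is not provable, so completeness fails. *)

theory Defs
  imports Complex_Main "HOL-Combinatorics.Permutations"
begin

datatype pfm = PVar nat | PNeg pfm | PAnd pfm pfm | POr pfm pfm

fun pvars :: "pfm \<Rightarrow> nat set" where
  "pvars (PVar p) = {p}"
| "pvars (PNeg \<phi>) = pvars \<phi>"
| "pvars (PAnd \<phi> \<psi>) = pvars \<phi> \<union> pvars \<psi>"
| "pvars (POr \<phi> \<psi>) = pvars \<phi> \<union> pvars \<psi>"

fun peval :: "(nat \<Rightarrow> bool) \<Rightarrow> pfm \<Rightarrow> bool" where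
  "peval v (PVar p) = v p"
| "peval v (PNeg \<phi>) = (\<not> peval v \<phi>)"
| "peval v (PAnd \<phi> \<psi>) = (peval v \<phi> \<and> peval v \<psi>)"
| "peval v (POr \<phi> \<psi>) = (peval v \<phi> \<or> peval v \<psi>)"

definition pequiv :: "pfm \<Rightarrow> pfm \<Rightarrow> bool" where
  "pequiv \<phi> \<psi> \<longleftrightarrow> (\<forall>v. peval v \<phi> = peval v \<psi>)"

definition fam_le :: "'a set set \<Rightarrow> 'a set set \<Rightarrow> bool" where
  "fam_le \<U> \<U>' \<longleftrightarrow> (\<forall>U\<in>\<U>. \<exists>U'\<in>\<U>'. U \<subseteq> U')"


text \<open>A team is a pair \<open>(\<Omega>, \<tau>)\<close>. The sets \<open>Q\<^sub>i\<close> are not a separate component: \<open>\<tau> i\<close> is a partial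
  function, and \<open>Q\<^sub>i\<close> is its domain.\<close>

type_synonym 'i team = "'i set \<times> ('i \<Rightarrow> nat \<rightharpoonup> bool)"

definition quantum_team :: "'i team \<Rightarrow> bool" where
  "quantum_team X \<longleftrightarrow>
     finite (fst X) \<and> (\<forall>i\<in>fst X. finite (dom (snd X i)) \<and> dom (snd X i) \<noteq> {})"

definition team_supp :: "'i team \<Rightarrow> nat set set" where
  "team_supp X = (\<lambda>i. dom (snd X i)) ` fst X"

definition team_over :: "'i team \<Rightarrow> nat set \<Rightarrow> 'i set" where
  "team_over X U = {i \<in> fst X. U \<subseteq> dom (snd X i)}"

definition holds_at :: "'i team \<Rightarrow> 'i \<Rightarrow> pfm \<Rightarrow> bool" where
  "holds_at X i \<phi> \<longleftrightarrow> peval (\<lambda>p. snd X i p = Some True) \<phi>"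

definition team_prob :: "'i team \<Rightarrow> nat set \<Rightarrow> pfm \<Rightarrow> real" where
  "team_prob X U \<phi> =
     real (card {i \<in> team_over X U. holds_at X i \<phi>}) / real (card (team_over X U))"


text \<open>The list of triples \<open>(a\<^sub>j, \<phi>\<^sub>j, V\<^sub>j)\<close> stands for the formal sum of the \<open>a\<^sub>j(\<phi>\<^sub>j;V\<^sub>j)\<close>.
  Repeated terms are kept apart and the empty sum is allowed.\<close>

type_synonym qterm = "(int \<times> pfm \<times> nat set) list"

datatype qfm = Geq qterm int | Neg qfm | Conj qfm qfm

fun qtl_formula :: "qfm \<Rightarrow> bool" where
  "qtl_formula (Geq t c) = (\<forall>(a, \<phi>, V) \<in> set t. finite V \<and> pvars \<phi> \<subseteq> V)"
| "qtl_formula (Neg \<alpha>) = qtl_formula \<alpha>"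
| "qtl_formula (Conj \<alpha> \<beta>) = (qtl_formula \<alpha> \<and> qtl_formula \<beta>)"

fun supp :: "qfm \<Rightarrow> nat set set" where
  "supp (Geq t c) = (\<lambda>(a, \<phi>, V). V) ` set t"
| "supp (Neg \<alpha>) = supp \<alpha>"
| "supp (Conj \<alpha> \<beta>) = supp \<alpha> \<union> supp \<beta>"

lemma finite_supp: "finite (supp \<alpha>)"
  by (induction \<alpha>) auto

lemma pvars_nonempty: "pvars \<phi> \<noteq> {}"
  by (induction \<phi>) auto

text \<open>There are no propositional constants, so the support of a formula is always one of the
  families by which the deductive system is parametrized.\<close>

lemma supp_members: "qtl_formula \<alpha> \<Longrightarrow> V \<in> supp \<alpha> \<Longrightarrow> finite V \<and> V \<noteq> {}"
  using pvars_nonempty by (induction \<alpha>) fastforce+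

definition Disj :: "qfm \<Rightarrow> qfm \<Rightarrow> qfm" where
  "Disj \<alpha> \<beta> = Neg (Conj (Neg \<alpha>) (Neg \<beta>))"

definition Imp :: "qfm \<Rightarrow> qfm \<Rightarrow> qfm" where
  "Imp \<alpha> \<beta> = Neg (Conj \<alpha> (Neg \<beta>))"

definition tscale :: "int \<Rightarrow> qterm \<Rightarrow> qterm" where
  "tscale d t = map (\<lambda>(a, x). (d * a, x)) t"

definition tminus :: "qterm \<Rightarrow> qterm \<Rightarrow> qterm" where
  "tminus t t' = t @ tscale (- 1) t'"

definition Leq :: "qterm \<Rightarrow> int \<Rightarrow> qfm" where
  "Leq t c = Geq (tscale (- 1) t) (- c)"

definition Greater :: "qterm \<Rightarrow> int \<Rightarrow> qfm" where
  "Greater t c = Neg (Leq t c)"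

definition Equal :: "qterm \<Rightarrow> int \<Rightarrow> qfm" where
  "Equal t c = Conj (Geq t c) (Leq t c)"

definition GeqT :: "qterm \<Rightarrow> qterm \<Rightarrow> qfm" where
  "GeqT t t' = Geq (tminus t t') 0"

definition EqualT :: "qterm \<Rightarrow> qterm \<Rightarrow> qfm" where
  "EqualT t t' = Equal (tminus t t') 0"


fun sat :: "'i team \<Rightarrow> qfm \<Rightarrow> bool" where
  "sat X (Geq t c) \<longleftrightarrow> (\<Sum>(a, \<phi>, V)\<leftarrow>t. of_int a * team_prob X V \<phi>) \<ge> of_int c"
| "sat X (Neg \<alpha>) \<longleftrightarrow> \<not> sat X \<alpha>"
| "sat X (Conj \<alpha> \<beta>) \<longleftrightarrow> sat X \<alpha> \<and> sat X \<beta>"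

text \<open>Validity quantifies over teams indexed by finite sets of natural numbers. This is no
  restriction: see \<open>valid_imp_sat\<close>.\<close>

definition valid :: "qfm \<Rightarrow> bool" where
  "valid \<alpha> \<longleftrightarrow> (\<forall>X :: nat team. quantum_team X \<and> fam_le (supp \<alpha>) (team_supp X) \<longrightarrow> sat X \<alpha>)"

lemma valid_imp_sat:
  fixes X :: "'i team"
  assumes "valid \<alpha>" and team: "quantum_team X" and le: "fam_le (supp \<alpha>) (team_supp X)"
  shows "sat X \<alpha>"
proof -
  have "finite (fst X)"
    using team by (simp add: quantum_team_def)
  then obtain f :: "'i \<Rightarrow> nat" where f: "inj_on f (fst X)"
    using finite_imp_inj_to_nat_seg by metis
  define Y :: "nat team" where "Y = (f ` fst X, \<lambda>n. snd X (inv_into (fst X) f n))"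
  have at: "snd Y (f i) = snd X i" if "i \<in> fst X" for i
    using that f by (simp add: Y_def)
  have over: "team_over Y U = f ` team_over X U" for U
    using at by (auto simp: team_over_def) (auto simp: Y_def f)
  have inj: "inj_on f (team_over X U)" for U
    using f by (rule inj_on_subset) (auto simp: team_over_def)
  have hold: "{n \<in> team_over Y U. holds_at Y n \<phi>} = f ` {i \<in> team_over X U. holds_at X i \<phi>}" for U \<phi>
    unfolding over using at by (auto simp: holds_at_def team_over_def)
  have "card {n \<in> team_over Y U. holds_at Y n \<phi>} = card {i \<in> team_over X U. holds_at X i \<phi>}" for U \<phi>
    unfolding hold by (rule card_image, rule inj_on_subset[OF inj]) auto
  moreover have "card (team_over Y U) = card (team_over X U)" for U
    unfolding over by (rule card_image[OF inj])
  ultimately have prob: "team_prob Y U \<phi> = team_prob X U \<phi>" for U \<phi>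
    by (simp add: team_prob_def)
  have sat_iff: "sat Y \<beta> = sat X \<beta>" for \<beta>
    by (induction \<beta>) (simp_all add: prob)
  have "team_supp Y = team_supp X"
    using at by (force simp: team_supp_def Y_def)
  moreover have "quantum_team Y"
    using team at by (auto simp: quantum_team_def Y_def)
  ultimately have "sat Y \<alpha>"
    using assms(1) le unfolding valid_def by metis
  then show ?thesis
    by (simp add: sat_iff)
qed


fun teval :: "(qterm \<Rightarrow> int \<Rightarrow> bool) \<Rightarrow> qfm \<Rightarrow> bool" where
  "teval v (Geq t c) = v t c"
| "teval v (Neg \<alpha>) = (\<not> teval v \<alpha>)"
| "teval v (Conj \<alpha> \<beta>) = (teval v \<alpha> \<and> teval v \<beta>)"

definition tautology :: "qfm \<Rightarrow> bool" where
  "tautology \<alpha> \<longleftrightarrow> (\<forall>v. teval v \<alpha>)"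

text \<open>Neither the axioms nor the rules mention well-formedness or the bound on supports; both are
  imposed on every member of a deduction.\<close>

inductive qtl_axiom :: "qfm \<Rightarrow> bool" where
  taut: "tautology \<alpha> \<Longrightarrow> qtl_axiom \<alpha>"
| nonneg: "qtl_axiom (Geq [(1, \<phi>, V)] 0)"
| total: "qtl_axiom (Equal [(1, POr \<phi> (PNeg \<phi>), V)] 1)"
| additive: "qtl_axiom (EqualT [(1, PAnd \<phi> \<psi>, V), (1, PAnd \<phi> (PNeg \<psi>), V)] [(1, \<phi>, V)])"
| equiv: "pequiv \<phi> \<psi> \<Longrightarrow> qtl_axiom (EqualT [(1, \<phi>, V)] [(1, \<psi>, V)])"
| refl: "qtl_axiom (GeqT [(1, \<phi>, V)] [(1, \<phi>, V)])"
| linear: "qtl_axiom (Disj (Geq t c) (Leq t c))"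

text \<open>\<open>qtl_rule \<V> \<alpha> \<beta>\<close>: the rule \<open>\<turnstile>\<^sub>\<V> \<alpha> \<Rightarrow> \<turnstile>\<^sub>\<V> \<beta>\<close>. These are all the rules except modus ponens.
  In \<open>add\<close> a list of quadruples \<open>(a\<^sub>j, b\<^sub>j, \<phi>\<^sub>j, V\<^sub>j)\<close> makes both sums range over the same
  \<open>(\<phi>\<^sub>j;V\<^sub>j)\<close>.\<close>

inductive qtl_rule :: "nat set set \<Rightarrow> qfm \<Rightarrow> qfm \<Rightarrow> bool" for \<V> where
  zero_intro: "qtl_rule \<V> (Geq t c) (Geq (t @ [(0, \<psi>, V)]) c)"
| zero_elim: "qtl_rule \<V> (Geq (t @ [(0, \<psi>, V)]) c) (Geq t c)"
| perm_intro: "\<sigma> permutes {..<length t} \<Longrightarrow> qtl_rule \<V> (Geq t c) (Geq (permute_list \<sigma> t) c)"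
| perm_elim: "\<sigma> permutes {..<length t} \<Longrightarrow> qtl_rule \<V> (Geq (permute_list \<sigma> t) c) (Geq t c)"
| add: "qtl_rule \<V> (Conj (Geq (map (\<lambda>(a, b, x). (a, x)) ts) c) (Geq (map (\<lambda>(a, b, x). (b, x)) ts) d))
                   (Geq (map (\<lambda>(a, b, x). (a + b, x)) ts) (c + d))"
| scale_intro: "d > 0 \<Longrightarrow> qtl_rule \<V> (Geq t c) (Geq (tscale d t) (d * c))"
| scale_elim: "d > 0 \<Longrightarrow> qtl_rule \<V> (Geq (tscale d t) (d * c)) (Geq t c)"
| strict: "c > d \<Longrightarrow> qtl_rule \<V> (Geq t c) (Greater t d)"
| supp_zero: "V \<subseteq> V' \<Longrightarrow> V' \<in> \<V> \<Longrightarrow> qtl_rule \<V> (Equal [(1, \<phi>, V)] 0) (Equal [(1, \<phi>, V')] 0)"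
| supp_one: "V \<subseteq> V' \<Longrightarrow> V' \<in> \<V> \<Longrightarrow> qtl_rule \<V> (Equal [(1, \<phi>, V)] 1) (Equal [(1, \<phi>, V')] 1)"

text \<open>The rules of \<open>qtl_rule\<close> may be used in the presence of a hypothesis \<open>\<gamma>\<close>: from \<open>\<gamma> \<rightarrow> \<alpha>\<close> infer
  \<open>\<gamma> \<rightarrow> \<beta>\<close>. Equivalently, each of them provides the implication \<open>\<alpha> \<rightarrow> \<beta>\<close>, as in the axiom system of
  Fagin, Halpern and Megiddo for linear inequalities. If the rules applied to theorems only, there
  would be no completeness: with distinct symbols \<open>p, q\<close> and \<open>V = {p, q}\<close>, the valid formula
  \<open>(p;V) - (q;V) \<ge> 1 \<rightarrow> (p;V) - (q;V) \<ge> 0\<close> would not be provable.\<close>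

inductive follows :: "nat set set \<Rightarrow> qfm set \<Rightarrow> qfm \<Rightarrow> bool" for \<V> \<Gamma> where
  mp: "Imp \<alpha> \<beta> \<in> \<Gamma> \<Longrightarrow> \<alpha> \<in> \<Gamma> \<Longrightarrow> follows \<V> \<Gamma> \<beta>"
| rule: "qtl_rule \<V> \<alpha> \<beta> \<Longrightarrow> \<alpha> \<in> \<Gamma> \<Longrightarrow> follows \<V> \<Gamma> \<beta>"
| rule_hyp: "qtl_rule \<V> \<alpha> \<beta> \<Longrightarrow> Imp \<gamma> \<alpha> \<in> \<Gamma> \<Longrightarrow> follows \<V> \<Gamma> (Imp \<gamma> \<beta>)"

definition deduction :: "nat set set \<Rightarrow> qfm list \<Rightarrow> bool" where
  "deduction \<V> \<alpha>s \<longleftrightarrow>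
     (\<forall>i<length \<alpha>s. qtl_formula (\<alpha>s ! i) \<and> fam_le (supp (\<alpha>s ! i)) \<V> \<and>
        (qtl_axiom (\<alpha>s ! i) \<or> follows \<V> (set (take i \<alpha>s)) (\<alpha>s ! i)))"

definition provable :: "qfm \<Rightarrow> bool" where
  "provable \<alpha> \<longleftrightarrow> (\<exists>\<alpha>s. deduction (supp \<alpha>) \<alpha>s \<and> \<alpha>s \<noteq> [] \<and> last \<alpha>s = \<alpha>)"

end

theory Submission
  imports Defs
begin

text \<open>Completeness. If \<open>\<alpha>\<close> is not provable, it is omitted by a complete theory \<open>T\<close>. The
  linear inequalities in \<open>T\<close> preorder the linear forms in the terms \<open>(\<phi>;V)\<close> totally and compatibly
  with addition. Such a preorder need not come from one rational point (it may have infinitesimals), but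
  on finitely many forms it does. Applied to \<open>\<alpha>\<close> and finitely many theorems, this gives
  rational weights on the truth assignments of each \<open>V\<close> in the support of \<open>\<alpha>\<close>, where by the rules for
  change of support an assignment of positive weight restricts to assignments of positive weight. These
  weights are the probabilities of a team that falsifies \<open>\<alpha>\<close>.\<close>

section \<open>Soundness\<close>

text \<open>A complete theory may contain (p;V) > 0 together with n(p;V) \<le> 1 for every n, so no
  team need satisfy all of it; hence only finitely many formulas are realized at once. The
  inequalities have integer coefficients, so the point can be kept rational, as it must be for its
  values to become ratios of counts. Weights at U and at a larger V are nearly independent: team
  members whose domain is exactly U change the ratios at U and none at V, and each support has its
  own denominator. Only the vanishing of a weight is inherited upwards, and change of support
  expresses just that.\<close>

definition lin :: "(pfm \<Rightarrow> nat set \<Rightarrow> 'a::linordered_field) \<Rightarrow> qterm \<Rightarrow> 'a" where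
  "lin x t = (\<Sum>(a, \<phi>, V)\<leftarrow>t. of_int a * x \<phi> V)"

lemma lin_simps [simp]:
  "lin x [] = 0"
  "lin x ((a, \<phi>, V) # t) = of_int a * x \<phi> V + lin x t"
  "lin x (t @ t') = lin x t + lin x t'"
  by (simp_all add: lin_def)

lemma lin_tscale [simp]: "lin x (tscale d t) = of_int d * lin x t"
  by (induction t) (auto simp: tscale_def algebra_simps)

lemma tscale_simps [simp]:
  "tscale d [] = []" "tscale d ((a, y) # t) = (d * a, y) # tscale d t"
  "tscale d (t @ t') = tscale d t @ tscale d t'"
  by (simp_all add: tscale_def)

lemma lin_mset_cong:
  assumes "mset t = mset t'"
  shows "lin x t = lin x t'"
proof -
  have "lin x u = sum_mset (image_mset (\<lambda>(a, \<phi>, V). of_int a * x \<phi> V) (mset u))" for u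
    by (simp add: lin_def flip: mset_map sum_mset_sum_list)
  then show ?thesis
    using assms by simp
qed

text \<open>The terms (\<phi>;V) are unknowns with arbitrary values \<open>x\<close>, not yet bound
  by any law of probability. The field is left open: points obtained from theories are rational,
  team probabilities are real.\<close>

fun models :: "(pfm \<Rightarrow> nat set \<Rightarrow> 'a::linordered_field) \<Rightarrow> qfm \<Rightarrow> bool" where
  "models x (Geq t c) \<longleftrightarrow> of_int c \<le> lin x t"
| "models x (Neg \<alpha>) \<longleftrightarrow> \<not> models x \<alpha>"
| "models x (Conj \<alpha> \<beta>) \<longleftrightarrow> models x \<alpha> \<and> models x \<beta>"

lemma models_abbrevs [simp]:
  "models x (Disj \<alpha> \<beta>) \<longleftrightarrow> models x \<alpha> \<or> models x \<beta>"
  "models x (Imp \<alpha> \<beta>) \<longleftrightarrow> (models x \<alpha> \<longrightarrow> models x \<beta>)"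
  "models x (Leq t c) \<longleftrightarrow> lin x t \<le> of_int c"
  "models x (Greater t c) \<longleftrightarrow> of_int c < lin x t"
  "models x (Equal t c) \<longleftrightarrow> lin x t = of_int c"
  "models x (GeqT t t') \<longleftrightarrow> lin x t' \<le> lin x t"
  "models x (EqualT t t') \<longleftrightarrow> lin x t = lin x t'"
  by (auto simp: Disj_def Imp_def Leq_def Greater_def Equal_def GeqT_def EqualT_def tminus_def)

lemma teval_models: "teval (\<lambda>t c. models x (Geq t c)) \<beta> = models x \<beta>"
  by (induction \<beta>) auto

lemma sat_eq_models: "sat X \<beta> \<longleftrightarrow> models (\<lambda>\<phi> V. team_prob X V \<phi>) \<beta>"
  by (induction \<beta>) (auto simp: lin_def)

lemma supp_abbrevs [simp]:
  "supp (Disj \<alpha> \<beta>) = supp \<alpha> \<union> supp \<beta>"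
  "supp (Imp \<alpha> \<beta>) = supp \<alpha> \<union> supp \<beta>"
  "supp (Leq t c) = supp (Geq t 0)"
  "supp (Greater t c) = supp (Geq t 0)"
  "supp (Equal t c) = supp (Geq t 0)"
  "supp (GeqT t t') = supp (Geq t 0) \<union> supp (Geq t' 0)"
  "supp (EqualT t t') = supp (Geq t 0) \<union> supp (Geq t' 0)"
  by (auto simp: Disj_def Imp_def Leq_def Greater_def Equal_def GeqT_def EqualT_def tminus_def
      tscale_def image_Un image_image split_beta)

lemma qtl_formula_abbrevs [simp]:
  "qtl_formula (Disj \<alpha> \<beta>) \<longleftrightarrow> qtl_formula \<alpha> \<and> qtl_formula \<beta>"
  "qtl_formula (Imp \<alpha> \<beta>) \<longleftrightarrow> qtl_formula \<alpha> \<and> qtl_formula \<beta>"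
  "qtl_formula (Leq t c) \<longleftrightarrow> qtl_formula (Geq t 0)"
  "qtl_formula (Greater t c) \<longleftrightarrow> qtl_formula (Geq t 0)"
  "qtl_formula (Equal t c) \<longleftrightarrow> qtl_formula (Geq t 0)"
  "qtl_formula (GeqT t t') \<longleftrightarrow> qtl_formula (Geq t 0) \<and> qtl_formula (Geq t' 0)"
  "qtl_formula (EqualT t t') \<longleftrightarrow> qtl_formula (Geq t 0) \<and> qtl_formula (Geq t' 0)"
  by (auto simp: Disj_def Imp_def Leq_def Greater_def Equal_def GeqT_def EqualT_def tminus_def
      tscale_def ball_Un split_beta)

section \<open>Probabilities in a team and truth along deductions\<close>

lemma team_prob_nonneg: "team_prob X U \<phi> \<ge> 0"
  by (simp add: team_prob_def)

lemma finite_team_over: "quantum_team X \<Longrightarrow> finite (team_over X U)"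
  by (auto simp: quantum_team_def team_over_def)

lemma team_over_nonempty: "fam_le {U} (team_supp X) \<Longrightarrow> team_over X U \<noteq> {}"
  by (auto simp: fam_le_def team_supp_def team_over_def)

lemma team_prob_zero_iff:
  assumes "quantum_team X" "fam_le {U} (team_supp X)"
  shows "team_prob X U \<phi> = 0 \<longleftrightarrow> (\<forall>i\<in>team_over X U. \<not> holds_at X i \<phi>)"
  using finite_team_over[OF assms(1), of U] team_over_nonempty[OF assms(2)]
  by (auto simp: team_prob_def)

lemma team_prob_compl:
  assumes "quantum_team X" "fam_le {U} (team_supp X)"
  shows "team_prob X U (PAnd \<phi> \<psi>) + team_prob X U (PAnd \<phi> (PNeg \<psi>)) = team_prob X U \<phi>"
proof -
  let ?O = "team_over X U"
  have "card {i \<in> ?O. holds_at X i \<phi>} =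
      card {i \<in> ?O. holds_at X i (PAnd \<phi> \<psi>)} + card {i \<in> ?O. holds_at X i (PAnd \<phi> (PNeg \<psi>))}"
    using finite_team_over[OF assms(1), of U]
    by (subst card_Un_disjoint[symmetric]) (auto simp: holds_at_def intro: arg_cong[where f = card])
  then show ?thesis
    by (simp add: team_prob_def add_divide_distrib)
qed

lemma team_prob_one_iff:
  assumes "quantum_team X" "fam_le {U} (team_supp X)"
  shows "team_prob X U \<phi> = 1 \<longleftrightarrow> (\<forall>i\<in>team_over X U. holds_at X i \<phi>)"
proof -
  let ?O = "team_over X U"
  have "finite ?O" "card ?O > 0"
    using finite_team_over[OF assms(1), of U] team_over_nonempty[OF assms(2)] by auto
  then have "team_prob X U \<phi> = 1 \<longleftrightarrow> card {i \<in> ?O. holds_at X i \<phi>} = card ?O"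
    by (auto simp: team_prob_def)
  also have "\<dots> \<longleftrightarrow> {i \<in> ?O. holds_at X i \<phi>} = ?O"
    using \<open>finite ?O\<close> by (metis (no_types, lifting) card_subset_eq mem_Collect_eq subsetI)
  finally show ?thesis
    by blast
qed

lemma sat_axiom:
  assumes X: "quantum_team X" and le: "fam_le (supp \<beta>) (team_supp X)" and ax: "qtl_axiom \<beta>"
  shows "sat X \<beta>"
  using ax le
proof cases
  case taut
  then show ?thesis
    unfolding sat_eq_models tautology_def by (metis teval_models)
next
  case (total \<phi> V)
  \<comment> \<open>The support bound matters here: with no index over V the quotient would be 0/0 =
    0 and the axiom would fail.\<close>
  then have "team_prob X V (POr \<phi> (PNeg \<phi>)) = 1"
    using le team_prob_one_iff[OF X, of V] by (auto simp: holds_at_def)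
  then show ?thesis
    by (simp add: total sat_eq_models)
next
  case (additive \<phi> \<psi> V)
  then show ?thesis
    using le by (auto simp: sat_eq_models team_prob_compl[OF X])
next
  case (equiv \<phi> \<psi> V)
  then show ?thesis
    by (simp add: sat_eq_models team_prob_def holds_at_def pequiv_def)
qed (auto simp: sat_eq_models team_prob_nonneg)

lemma lin_unzip_add:
  "lin x (map (\<lambda>(a, b, y). (a + b, y)) ts) =
     lin x (map (\<lambda>(a, b, y). (a, y)) ts) + lin x (map (\<lambda>(a, b, y). (b, y)) ts)"
  by (induction ts) (auto simp: algebra_simps)

lemma lin_permute_list: "\<sigma> permutes {..<length t} \<Longrightarrow> lin x (permute_list \<sigma> t) = lin x t"
  by (rule lin_mset_cong) (rule mset_permute_list)

lemma fam_le_trans: "fam_le A B \<Longrightarrow> fam_le B C \<Longrightarrow> fam_le A C"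
  unfolding fam_le_def by (meson subset_trans)

lemma fam_le_simps [simp]:
  "fam_le (A \<union> B) C \<longleftrightarrow> fam_le A C \<and> fam_le B C"
  "fam_le {} C"
  "fam_le (insert U A) C \<longleftrightarrow> (\<exists>U'\<in>C. U \<subseteq> U') \<and> fam_le A C"
  by (auto simp: fam_le_def)

text \<open>Probability 0 or 1 is a universal statement over \<open>team_over X V\<close>, so it
  passes to the smaller \<open>team_over X V'\<close>. Soundness of the change of support rests on
  this.\<close>

lemma team_over_antimono: "V \<subseteq> V' \<Longrightarrow> team_over X V' \<subseteq> team_over X V"
  by (auto simp: team_over_def)

text \<open>The rules preserve truth in each single team, not merely validity, which keeps them
  sound under a hypothesis. The team is bounded by \<V> because change of support may introduce a
  member of \<V> that does not occur in \<alpha>.\<close>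

lemma sat_rule:
  assumes X: "quantum_team X" and le: "fam_le \<V> (team_supp X)"
    and rule: "qtl_rule \<V> \<alpha> \<beta>" and sat: "sat X \<alpha>"
  shows "sat X \<beta>"
  using rule
proof cases
  case (supp_zero V V' \<phi>)
  then have "fam_le {V} (team_supp X)" "fam_le {V'} (team_supp X)"
    using le by (auto simp: fam_le_def) (meson subset_trans)
  then show ?thesis
    using sat supp_zero team_over_antimono[of V V' X]
    by (auto simp: sat_eq_models team_prob_zero_iff[OF X])
next
  case (supp_one V V' \<phi>)
  then have "fam_le {V} (team_supp X)" "fam_le {V'} (team_supp X)"
    using le by (auto simp: fam_le_def) (meson subset_trans)
  then show ?thesis
    using sat supp_one team_over_antimono[of V V' X]
    by (auto simp: sat_eq_models team_prob_one_iff[OF X])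
next
  case (strict c d t)
  then show ?thesis
    using sat by (auto simp: sat_eq_models elim: order.strict_trans2[rotated])
next
  case (scale_intro d t c)
  then show ?thesis
    using sat by (auto simp: sat_eq_models)
next
  case (scale_elim d t c)
  then show ?thesis
    using sat by (auto simp: sat_eq_models)
qed (use sat in \<open>auto simp: sat_eq_models lin_permute_list lin_unzip_add\<close>)

lemma sat_follows:
  assumes X: "quantum_team X" and le: "fam_le \<V> (team_supp X)"
    and "follows \<V> \<Gamma> \<beta>" and sat: "\<And>\<gamma>. \<gamma> \<in> \<Gamma> \<Longrightarrow> sat X \<gamma>"
  shows "sat X \<beta>"
  using assms(3)
proof cases
  case (mp \<alpha>)
  then show ?thesis
    using sat[of "Imp \<alpha> \<beta>"] sat[of \<alpha>] by (auto simp: sat_eq_models)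
next
  case (rule \<alpha>)
  then show ?thesis
    using sat sat_rule[OF X le] by blast
next
  case (rule_hyp \<alpha> \<beta>' \<gamma>)
  then show ?thesis
    using sat[of "Imp \<gamma> \<alpha>"] sat_rule[OF X le rule_hyp(2)] by (auto simp: sat_eq_models)
qed

text \<open>Every line of a deduction has its support below \<V>, so a team large enough for \<V>
  interprets the intermediate formulas too, whatever terms they contain.\<close>

lemma sat_deduction:
  assumes X: "quantum_team X" and le: "fam_le \<V> (team_supp X)"
    and ded: "deduction \<V> \<alpha>s" and "i < length \<alpha>s"
  shows "sat X (\<alpha>s ! i)"
  using \<open>i < length \<alpha>s\<close>
proof (induction i rule: less_induct)
  case (less i)
  then have "sat X \<gamma>" if "\<gamma> \<in> set (take i \<alpha>s)" for \<gamma>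
    using that by (auto simp: in_set_conv_nth)
  moreover have "fam_le (supp (\<alpha>s ! i)) (team_supp X)"
    using ded less.prems le fam_le_trans unfolding deduction_def by blast
  ultimately show ?case
    using ded less.prems sat_axiom[OF X] sat_follows[OF X le] unfolding deduction_def by blast
qed

lemma provable_imp_valid: "provable \<alpha> \<Longrightarrow> valid \<alpha>"
  unfolding provable_def valid_def
  by (metis diff_less last_conv_nth length_greater_0_conv sat_deduction zero_less_one)

section \<open>Complete theories\<close>

definition wff :: "nat set set \<Rightarrow> qfm set" where
  "wff \<V> = {\<beta>. qtl_formula \<beta> \<and> fam_le (supp \<beta>) \<V>}"

text \<open>Any position in a deduction counts, since initial segments are again deductions
  (\<open>deduction_take\<close>).\<close>

definition theorems :: "nat set set \<Rightarrow> qfm set" where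
  "theorems \<V> = {\<beta>. \<exists>\<alpha>s. deduction \<V> \<alpha>s \<and> \<beta> \<in> set \<alpha>s}"

lemma follows_mono: "follows \<V> \<Gamma> \<beta> \<Longrightarrow> \<Gamma> \<subseteq> \<Gamma>' \<Longrightarrow> follows \<V> \<Gamma>' \<beta>"
  by (induction rule: follows.induct) (blast intro: follows.intros)+

lemma deduction_take: "deduction \<V> \<alpha>s \<Longrightarrow> deduction \<V> (take n \<alpha>s)"
  by (auto simp: deduction_def min_def)

lemma deduction_append:
  assumes "deduction \<V> \<alpha>s" "deduction \<V> \<beta>s"
  shows "deduction \<V> (\<alpha>s @ \<beta>s)"
  unfolding deduction_def
proof (intro allI impI)
  fix i assume "i < length (\<alpha>s @ \<beta>s)"
  then show "qtl_formula ((\<alpha>s @ \<beta>s) ! i) \<and> fam_le (supp ((\<alpha>s @ \<beta>s) ! i)) \<V> \<and>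
      (qtl_axiom ((\<alpha>s @ \<beta>s) ! i) \<or> follows \<V> (set (take i (\<alpha>s @ \<beta>s))) ((\<alpha>s @ \<beta>s) ! i))"
    using assms unfolding deduction_def
    by (cases "i < length \<alpha>s")
      (auto simp: nth_append elim!: follows_mono, (metis Un_upper2 add_diff_inverse_nat follows_mono nat_add_left_cancel_less)+)
qed

lemma deduction_snoc:
  assumes "deduction \<V> \<alpha>s" "\<beta> \<in> wff \<V>" "qtl_axiom \<beta> \<or> follows \<V> (set \<alpha>s) \<beta>"
  shows "deduction \<V> (\<alpha>s @ [\<beta>])"
  using assms by (auto simp: deduction_def wff_def nth_append less_Suc_eq)

lemma theorems_provable: "\<alpha> \<in> theorems (supp \<alpha>) \<Longrightarrow> provable \<alpha>"
proof -
  assume "\<alpha> \<in> theorems (supp \<alpha>)"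
  then obtain \<alpha>s i where "deduction (supp \<alpha>) \<alpha>s" "i < length \<alpha>s" "\<alpha>s ! i = \<alpha>"
    by (auto simp: theorems_def in_set_conv_nth)
  then show ?thesis
    unfolding provable_def
    using deduction_take[of _ \<alpha>s "Suc i"]
    by (intro exI[of _ "take (Suc i) \<alpha>s"]) (auto simp: take_Suc_conv_app_nth)
qed

lemma theorems_subset_wff: "theorems \<V> \<subseteq> wff \<V>"
  by (auto simp: theorems_def wff_def deduction_def in_set_conv_nth)

lemma theorems_axiom: "qtl_axiom \<beta> \<Longrightarrow> \<beta> \<in> wff \<V> \<Longrightarrow> \<beta> \<in> theorems \<V>"
  using deduction_snoc[of \<V> "[]" \<beta>] by (auto simp: theorems_def intro!: exI[of _ "[\<beta>]"]) (simp add: deduction_def)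

lemma theorems_mp:
  assumes "Imp \<alpha> \<beta> \<in> theorems \<V>" "\<alpha> \<in> theorems \<V>"
  shows "\<beta> \<in> theorems \<V>"
proof -
  obtain \<alpha>s \<beta>s where "deduction \<V> \<alpha>s" "Imp \<alpha> \<beta> \<in> set \<alpha>s" "deduction \<V> \<beta>s" "\<alpha> \<in> set \<beta>s"
    using assms by (auto simp: theorems_def)
  moreover have "\<beta> \<in> wff \<V>"
    using assms theorems_subset_wff[of \<V>] by (auto simp: wff_def)
  ultimately have "deduction \<V> ((\<alpha>s @ \<beta>s) @ [\<beta>])"
    by (intro deduction_snoc deduction_append disjI2 follows.mp[of \<alpha>]) auto
  then show ?thesis
    unfolding theorems_def by fastforce
qed

lemma wff_simps [simp]:
  "Neg \<alpha> \<in> wff \<V> \<longleftrightarrow> \<alpha> \<in> wff \<V>"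
  "Conj \<alpha> \<beta> \<in> wff \<V> \<longleftrightarrow> \<alpha> \<in> wff \<V> \<and> \<beta> \<in> wff \<V>"
  "Imp \<alpha> \<beta> \<in> wff \<V> \<longleftrightarrow> \<alpha> \<in> wff \<V> \<and> \<beta> \<in> wff \<V>"
  by (auto simp: wff_def)

lemma theorems_tautology: "tautology \<beta> \<Longrightarrow> \<beta> \<in> wff \<V> \<Longrightarrow> \<beta> \<in> theorems \<V>"
  by (simp add: theorems_axiom qtl_axiom.taut)

lemma teval_abbrevs [simp]:
  "teval v (Disj \<alpha> \<beta>) \<longleftrightarrow> teval v \<alpha> \<or> teval v \<beta>"
  "teval v (Imp \<alpha> \<beta>) \<longleftrightarrow> (teval v \<alpha> \<longrightarrow> teval v \<beta>)"
  by (auto simp: Disj_def Imp_def)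

text \<open>The hypothesis in \<open>rule_hyp\<close> is taken to be \<alpha> itself, with the
  tautology \<open>Imp \<alpha> \<alpha>\<close> as premise. Thus every rule becomes an implication,
  available inside theories.\<close>

lemma theorems_rule:
  assumes "qtl_rule \<V> \<alpha> \<beta>" "\<alpha> \<in> wff \<V>" "\<beta> \<in> wff \<V>"
  shows "Imp \<alpha> \<beta> \<in> theorems \<V>"
proof -
  have "Imp \<alpha> \<alpha> \<in> theorems \<V>"
    using assms by (intro theorems_tautology) (auto simp: tautology_def)
  then obtain \<alpha>s where "deduction \<V> \<alpha>s" "Imp \<alpha> \<alpha> \<in> set \<alpha>s"
    by (auto simp: theorems_def)
  then have "deduction \<V> (\<alpha>s @ [Imp \<alpha> \<beta>])"
    using assms by (intro deduction_snoc disjI2 follows.rule_hyp[of \<V> \<alpha>]) auto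
  then show ?thesis
    unfolding theorems_def by fastforce
qed

text \<open>Closure under modus ponens suffices: the other rules are present as implications among
  the theorems, by \<open>theorems_rule\<close>.\<close>

definition qtl_theory :: "nat set set \<Rightarrow> qfm set \<Rightarrow> bool" where
  "qtl_theory \<V> T \<longleftrightarrow> theorems \<V> \<subseteq> T \<and> T \<subseteq> wff \<V> \<and> (\<forall>\<alpha> \<beta>. Imp \<alpha> \<beta> \<in> T \<longrightarrow> \<alpha> \<in> T \<longrightarrow> \<beta> \<in> T)"

lemma qtl_theory_theorems: "qtl_theory \<V> (theorems \<V>)"
  unfolding qtl_theory_def using theorems_mp theorems_subset_wff by blast

text \<open>This is the deduction theorem: as modus ponens is the only closure condition, the
  consequences of T and \<beta> are the \<gamma> with \<open>Imp \<beta> \<gamma>\<close> in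
  T.\<close>

lemma qtl_theory_adjoin:
  assumes T: "qtl_theory \<V> T" and \<beta>: "\<beta> \<in> wff \<V>"
  shows "qtl_theory \<V> {\<gamma> \<in> wff \<V>. Imp \<beta> \<gamma> \<in> T}" (is "qtl_theory \<V> ?T'")
    and "T \<subseteq> {\<gamma> \<in> wff \<V>. Imp \<beta> \<gamma> \<in> T}" and "\<beta> \<in> {\<gamma> \<in> wff \<V>. Imp \<beta> \<gamma> \<in> T}"
proof -
  have taut: "\<gamma> \<in> T" if "tautology \<gamma>" "\<gamma> \<in> wff \<V>" for \<gamma>
    using T that theorems_tautology unfolding qtl_theory_def by blast
  have mp: "Imp \<gamma> \<delta> \<in> T \<Longrightarrow> \<gamma> \<in> T \<Longrightarrow> \<delta> \<in> T" for \<gamma> \<delta>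
    using T unfolding qtl_theory_def by blast
  have Tw: "T \<subseteq> wff \<V>"
    using T unfolding qtl_theory_def by blast
  show sub: "T \<subseteq> ?T'"
  proof
    fix \<gamma> assume \<gamma>: "\<gamma> \<in> T"
    have "Imp \<gamma> (Imp \<beta> \<gamma>) \<in> T"
      using \<gamma> Tw \<beta> by (intro taut) (auto simp: tautology_def)
    then show "\<gamma> \<in> ?T'"
      using \<gamma> mp Tw by blast
  qed
  show "\<beta> \<in> ?T'"
    using \<beta> by (auto intro!: taut simp: tautology_def)
  have "\<delta> \<in> ?T'" if "Imp \<gamma> \<delta> \<in> ?T'" "\<gamma> \<in> ?T'" for \<gamma> \<delta>
  proof -
    have "Imp (Imp \<beta> (Imp \<gamma> \<delta>)) (Imp (Imp \<beta> \<gamma>) (Imp \<beta> \<delta>)) \<in> T"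
      using that \<beta> by (intro taut) (auto simp: tautology_def)
    then show ?thesis
      using that mp by (auto simp del: teval.simps)
  qed
  then show "qtl_theory \<V> ?T'"
    using T sub unfolding qtl_theory_def by blast
qed

locale complete_theory =
  fixes \<V> T
  assumes thy: "qtl_theory \<V> T"
    and Neg_iff: "\<beta> \<in> wff \<V> \<Longrightarrow> Neg \<beta> \<in> T \<longleftrightarrow> \<beta> \<notin> T"

text \<open>Let M be maximal among the theories omitting \<alpha>. Adjoining a formula \<beta>
  outside M must yield \<alpha>, so \<open>Imp \<beta> \<alpha>\<close> is in M. If \<beta> and its
  negation were both outside M, a case distinction would put \<alpha> into M.\<close>

lemma lindenbaum:
  assumes \<alpha>: "\<alpha> \<in> wff \<V>" "\<alpha> \<notin> theorems \<V>"
  obtains T where "complete_theory \<V> T" "\<alpha> \<notin> T"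
proof -
  let ?\<A> = "{T. qtl_theory \<V> T \<and> \<alpha> \<notin> T}"
  have "\<exists>M\<in>?\<A>. \<forall>X\<in>?\<A>. M \<subseteq> X \<longrightarrow> X = M"
  proof (rule subset_Zorn_nonempty)
    show "?\<A> \<noteq> {}"
      using qtl_theory_theorems \<alpha> by blast
  next
    fix C assume C: "C \<noteq> {}" "subset.chain ?\<A> C"
    then have sub: "C \<subseteq> ?\<A>" and ch: "\<And>S T. S \<in> C \<Longrightarrow> T \<in> C \<Longrightarrow> S \<subseteq> T \<or> T \<subseteq> S"
      by (auto simp: subset_chain_def)
    have "\<delta> \<in> \<Union>C" if asm: "Imp \<gamma> \<delta> \<in> \<Union>C" "\<gamma> \<in> \<Union>C" for \<gamma> \<delta>
    proof -
      obtain S S' where S: "S \<in> C" "Imp \<gamma> \<delta> \<in> S" "S' \<in> C" "\<gamma> \<in> S'"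
        using asm by blast
      moreover have "S \<subseteq> S' \<or> S' \<subseteq> S"
        using S ch by blast
      ultimately obtain S where "S \<in> C" "Imp \<gamma> \<delta> \<in> S" "\<gamma> \<in> S"
        by blast
      then show ?thesis
        using sub unfolding qtl_theory_def by blast
    qed
    then show "\<Union>C \<in> ?\<A>"
      using sub C(1) unfolding qtl_theory_def by blast
  qed
  then obtain M where M: "qtl_theory \<V> M" "\<alpha> \<notin> M"
    and max: "\<And>X. qtl_theory \<V> X \<Longrightarrow> \<alpha> \<notin> X \<Longrightarrow> M \<subseteq> X \<Longrightarrow> X = M"
    by blast
  have taut: "\<gamma> \<in> M" if "tautology \<gamma>" "\<gamma> \<in> wff \<V>" for \<gamma>
    using M that theorems_tautology unfolding qtl_theory_def by blast
  have mp: "Imp \<gamma> \<delta> \<in> M \<Longrightarrow> \<gamma> \<in> M \<Longrightarrow> \<delta> \<in> M" for \<gamma> \<delta>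
    using M unfolding qtl_theory_def by blast
  have imp: "Imp \<beta> \<alpha> \<in> M" if "\<beta> \<in> wff \<V>" "\<beta> \<notin> M" for \<beta>
    using qtl_theory_adjoin[OF M(1) that(1)] max that by blast
  have "Neg \<beta> \<in> M \<longleftrightarrow> \<beta> \<notin> M" if \<beta>: "\<beta> \<in> wff \<V>" for \<beta>
  proof
    assume "Neg \<beta> \<in> M"
    moreover have "Imp (Neg \<beta>) (Imp \<beta> \<alpha>) \<in> M"
      using \<alpha> \<beta> by (intro taut) (auto simp: tautology_def)
    ultimately show "\<beta> \<notin> M"
      using mp M(2) by blast
  next
    assume "\<beta> \<notin> M"
    then have "Imp \<beta> \<alpha> \<in> M"
      using imp \<beta> by blast
    moreover have "Imp (Imp \<beta> \<alpha>) (Imp (Imp (Neg \<beta>) \<alpha>) \<alpha>) \<in> M"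
      using \<alpha> \<beta> by (intro taut) (auto simp: tautology_def)
    ultimately show "Neg \<beta> \<in> M"
      using imp[of "Neg \<beta>"] mp M(2) \<beta> by (metis wff_simps(1))
  qed
  then show ?thesis
    using that[of M] M by (simp add: complete_theory_def)
qed

section \<open>Finite parts of ordered spaces of linear forms\<close>

lemma finite_sets_separated:
  fixes A B :: "'a::{dense_linorder, no_top, no_bot} set"
  assumes "finite A" "finite B" "\<And>a b. a \<in> A \<Longrightarrow> b \<in> B \<Longrightarrow> a < b"
  obtains y where "\<And>a. a \<in> A \<Longrightarrow> a < y" "\<And>b. b \<in> B \<Longrightarrow> y < b"
proof -
  have "\<exists>y. (\<forall>a\<in>A. a < y) \<and> (\<forall>b\<in>B. y < b)"
  proof (cases "A = {} \<or> B = {}")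
    case True
    obtain z where "A \<noteq> {} \<Longrightarrow> Max A < z"
      using gt_ex by blast
    moreover obtain w where "B \<noteq> {} \<Longrightarrow> w < Min B"
      using lt_ex by blast
    ultimately show ?thesis
      using True assms(1,2) by (metis Max_less_iff Min_gr_iff empty_iff)
  next
    case False
    then have "Max A < Min B"
      using assms by simp
    then obtain y where "Max A < y" "y < Min B"
      using dense by blast
    then show ?thesis
      using False assms(1,2) by (intro exI[of _ y]) (simp add: Max_less_iff Min_gr_iff)
  qed
  then show ?thesis
    using that by blast
qed

text \<open>\<open>P f\<close> is read as \<open>f \<ge> 0\<close> for the linear form \<open>f\<close>, whose coefficient at \<open>u\<close> is the constant
  term. The induction eliminates one variable \<open>n\<close>: solved for \<open>n\<close>, every form compares \<open>n\<close> with a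
  form \<open>g\<close> in the remaining variables, and \<open>P\<close> preorders these \<open>g\<close> linearly. A point that gives all
  \<open>g\<close> the right order therefore extends by placing \<open>n\<close> in the right gap.\<close>

lemma cone_point:
  fixes P :: "('v \<Rightarrow> rat) \<Rightarrow> bool"
  assumes add: "\<And>f g. P f \<Longrightarrow> P g \<Longrightarrow> P (\<lambda>i. f i + g i)"
    and scale: "\<And>q f. q > 0 \<Longrightarrow> P f \<Longrightarrow> P (\<lambda>i. q * f i)"
    and total: "\<And>f. P f \<or> P (\<lambda>i. - f i)"
    and pos: "\<not> P (\<lambda>i. - of_bool (i = u))"
    and "finite I" "u \<notin> I"
    and "finite F" "\<And>f i. f \<in> F \<Longrightarrow> i \<notin> insert u I \<Longrightarrow> f i = 0"
  shows "\<exists>x. x u = 1 \<and> (\<forall>f\<in>F. P f \<longleftrightarrow> 0 \<le> (\<Sum>i\<in>insert u I. f i * x i))"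
  using assms(5-)
proof (induction I arbitrary: F rule: finite_induct)
  case empty
  have "P f \<longleftrightarrow> 0 \<le> f u" if "f \<in> F" for f
  proof -
    have f: "f = (\<lambda>i. f u * of_bool (i = u))"
      using empty.prems(3)[OF that] by fastforce
    have unit: "P (\<lambda>i. of_bool (i = u))"
      using total pos by blast
    have zero: "P (\<lambda>i. 0)"
      using total[of "\<lambda>i. 0"] by simp
    consider "f u > 0" | "f u = 0" | "f u < 0"
      by linarith
    then show ?thesis
    proof cases
      case 1
      then have "P f"
        using scale[OF _ unit, of "f u"] by (simp only: f[symmetric])
      with 1 show ?thesis
        by simp
    next
      case 2
      then have "f = (\<lambda>i. 0)"
        using f by simp
      with zero show ?thesis
        by simp
    next
      case 3
      \<comment> \<open>The factor is positive since f u < 0, so \<open>P f\<close> would give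
        nonnegativity of the form -1, against \<open>pos\<close>.\<close>
      have "(\<lambda>i. (- 1 / f u) * f i) = (\<lambda>i. - of_bool (i = u))"
      proof
        show "(- 1 / f u) * f i = - of_bool (i = u)" for i
          using 3 fun_cong[OF f, of i] by (cases "i = u") auto
      qed
      then have "\<not> P f"
        using scale[of "- 1 / f u" f] pos 3 by auto
      with 3 show ?thesis
        by simp
    qed
  qed
  then show ?case
    by (intro exI[of _ "\<lambda>_. 1"]) simp
next
  case (insert n J)
  \<comment> \<open>\<open>e\<close> is the variable n as a form, and f equals f n times the
    difference of \<open>e\<close> and \<open>g f\<close>. So \<open>g f\<close> is free of n and
    bounds n from the side given by the sign of f n. \<open>F'\<close> contains all differences of
    such bounds, so that the induction hypothesis orders them as \<open>P\<close> does.\<close>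
  define e where "e = (\<lambda>i. of_bool (i = n) :: rat)"
  define g where "g = (\<lambda>f i. e i - f i / f n)"
  define B where "B = g ` {f \<in> F. f n \<noteq> 0}"
  define F' where "F' = {f \<in> F. f n = 0} \<union> (\<lambda>(g, h) i. g i - h i) ` (B \<times> B)"
  have un: "u \<noteq> n"
    using insert.prems(1) by auto
  have B0: "b i = 0" if "b \<in> B" "i \<notin> insert u J" for b i
    using that insert.prems(3) by (cases "i = n") (auto simp: B_def g_def e_def)
  have finB: "finite B"
    using insert.prems(2) by (simp add: B_def)
  have "\<exists>x. x u = 1 \<and> (\<forall>f\<in>F'. P f \<longleftrightarrow> 0 \<le> (\<Sum>i\<in>insert u J. f i * x i))"
  proof (rule insert.IH)
    show "finite F'"
      using insert.prems(2) finB by (simp add: F'_def)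
    show "f i = 0" if "f \<in> F'" "i \<notin> insert u J" for f i
    proof -
      consider "f \<in> F" "f n = 0" | b c where "b \<in> B" "c \<in> B" "f = (\<lambda>i. b i - c i)"
        using \<open>f \<in> F'\<close> by (auto simp: F'_def)
      then show ?thesis
      proof cases
        case 1
        then show ?thesis
          using that insert.prems(3)[of f i] by (cases "i = n") auto
      next
        case 2
        then show ?thesis
          using that B0[of b i] B0[of c i] by simp
      qed
    qed
  qed (use insert.prems in auto)
  then obtain x where x: "x u = 1"
      "\<And>f. f \<in> F' \<Longrightarrow> P f \<longleftrightarrow> 0 \<le> (\<Sum>i\<in>insert u J. f i * x i)"
    by blast
  define v where "v = (\<lambda>b. \<Sum>i\<in>insert u J. b i * x i)"
  have diff: "P (\<lambda>i. b i - c i) \<longleftrightarrow> v c \<le> v b" if "b \<in> B" "c \<in> B" for b c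
  proof -
    have "(\<lambda>i. b i - c i) \<in> F'"
      using that by (auto simp: F'_def)
    then show ?thesis
      using x(2) by (simp add: v_def left_diff_distrib sum_subtractf)
  qed
  have chain: "P (\<lambda>i. a i - c i)" if "P (\<lambda>i. a i - b i)" "P (\<lambda>i. b i - c i)" for a b c
    using add[OF that] by simp
  have tot: "P (\<lambda>i. a i - b i) \<or> P (\<lambda>i. b i - a i)" for a b
    using total[of "\<lambda>i. a i - b i"] by simp
  \<comment> \<open>If the preorder identifies n with some bound b, the value v b is forced.
    Otherwise all lower bounds have values strictly below those of the upper bounds, and any y
    strictly between will do.\<close>
  have "\<exists>y. \<forall>b\<in>B. (P (\<lambda>i. e i - b i) \<longleftrightarrow> v b \<le> y) \<and> (P (\<lambda>i. b i - e i) \<longleftrightarrow> y \<le> v b)"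
  proof (cases "\<exists>b\<in>B. P (\<lambda>i. e i - b i) \<and> P (\<lambda>i. b i - e i)")
    case True
    then obtain b where b: "b \<in> B" "P (\<lambda>i. e i - b i)" "P (\<lambda>i. b i - e i)"
      by blast
    have "P (\<lambda>i. e i - c i) \<longleftrightarrow> v c \<le> v b" "P (\<lambda>i. c i - e i) \<longleftrightarrow> v b \<le> v c" if "c \<in> B" for c
      using b that chain diff by blast+
    then show ?thesis
      by blast
  next
    case False
    let ?L = "{b \<in> B. P (\<lambda>i. e i - b i)}" and ?U = "{b \<in> B. P (\<lambda>i. b i - e i)}"
    have lt: "v b < v c" if "b \<in> ?L" "c \<in> ?U" for b c
    proof (rule ccontr)
      assume "\<not> v b < v c"
      then have "P (\<lambda>i. b i - c i)"
        using that diff by auto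
      then show False
        using that False chain[of b c e] by auto
    qed
    have "finite (v ` ?L)" "finite (v ` ?U)" "\<And>a b. a \<in> v ` ?L \<Longrightarrow> b \<in> v ` ?U \<Longrightarrow> a < b"
      using finB lt by auto
    then obtain y where "\<And>a. a \<in> v ` ?L \<Longrightarrow> a < y" "\<And>b. b \<in> v ` ?U \<Longrightarrow> y < b"
      using finite_sets_separated[of "v ` ?L" "v ` ?U"] by blast
    then have y: "\<And>b. b \<in> ?L \<Longrightarrow> v b < y" "\<And>b. b \<in> ?U \<Longrightarrow> y < v b"
      by blast+
    have "(P (\<lambda>i. e i - b i) \<longleftrightarrow> v b \<le> y) \<and> (P (\<lambda>i. b i - e i) \<longleftrightarrow> y \<le> v b)" if "b \<in> B" for b
    proof (cases "P (\<lambda>i. e i - b i)")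
      case True
      then show ?thesis
        using that False y(1)[of b] by auto
    next
      case neg: False
      then show ?thesis
        using that tot[of e b] y(2)[of b] by auto
    qed
    then show ?thesis
      by blast
  qed
  then obtain y where y: "\<And>b. b \<in> B \<Longrightarrow> P (\<lambda>i. e i - b i) \<longleftrightarrow> v b \<le> y"
      "\<And>b. b \<in> B \<Longrightarrow> P (\<lambda>i. b i - e i) \<longleftrightarrow> y \<le> v b"
    by blast
  have eval_at: "(\<Sum>i\<in>insert u (insert n J). f i * (x(n := y)) i) = f n * y + v f" for f
  proof -
    have "(\<Sum>i\<in>insert u J. f i * (x(n := y)) i) = v f"
      unfolding v_def using insert.hyps(2) un by (intro sum.cong) auto
    moreover have "insert u (insert n J) = insert n (insert u J)" "n \<notin> insert u J" "finite (insert u J)"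
      using insert.hyps un by auto
    ultimately show ?thesis
      by (simp del: sum.insert_if sum.insert add: sum.insert[of "insert u J" n] fun_upd_def)
  qed
  have "P f \<longleftrightarrow> 0 \<le> (\<Sum>i\<in>insert u (insert n J). f i * (x(n := y)) i)" if f: "f \<in> F" for f
  proof (cases "f n = 0")
    case True
    then show ?thesis
      using x(2)[of f] f unfolding eval_at by (simp add: F'_def v_def)
  next
    case False
    let ?k = "f n"
    have b: "g f \<in> B"
      using f False by (simp add: B_def)
    have f_eq: "f = (\<lambda>i. ?k * (e i - g f i))"
      using False by (simp add: g_def)
    have ve: "v e = 0"
      unfolding v_def e_def using insert.hyps(2) un by (intro sum.neutral) auto
    have "v f = ?k * (v e - v (g f))"
      by (subst f_eq)
        (simp only: v_def sum_distrib_left flip: sum_subtractf, simp add: algebra_simps)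
    then have val: "f n * y + v f = ?k * (y - v (g f))"
      by (simp add: ve algebra_simps)
    have scale_iff: "P (\<lambda>i. q * h i) \<longleftrightarrow> P h" if "q > 0" for q h
      using scale[of q h] scale[of "1 / q" "\<lambda>i. q * h i"] that by auto
    show ?thesis
    proof (cases "?k > 0")
      case True
      have "P f \<longleftrightarrow> P (\<lambda>i. e i - g f i)"
        by (subst f_eq) (rule scale_iff[OF True])
      then show ?thesis
        unfolding eval_at val using y(1)[OF b] True by (simp add: zero_le_mult_iff)
    next
      case neg: False
      have "f = (\<lambda>i. - ?k * (g f i - e i))"
        using False by (simp add: g_def)
      then have "P f \<longleftrightarrow> P (\<lambda>i. g f i - e i)"
        using scale_iff[of "- ?k" "\<lambda>i. g f i - e i"] neg False by simp
      then show ?thesis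
        unfolding eval_at val using y(2)[OF b] neg False by (simp add: zero_le_mult_iff)
    qed
  qed
  then show ?case
    using un x(1) by (intro exI[of _ "x(n := y)"]) (simp del: sum.insert_if sum.insert)
qed

lemma common_denominator:
  fixes f :: "'b \<Rightarrow> rat"
  assumes "finite S"
  shows "\<exists>d>0. \<forall>y\<in>S. \<exists>k. of_int k = of_int d * f y"
  using assms
proof (induction S rule: finite_induct)
  case (insert z S)
  then obtain d where d: "d > 0" "\<forall>y\<in>S. \<exists>k. of_int k = of_int d * f y"
    by blast
  obtain m n :: int where q: "f z = of_int m / of_int n" "n > 0"
    by (cases "f z") (auto simp: Fract_of_int_quotient)
  have "\<exists>k. of_int k = of_int (d * n) * f y" if y: "y \<in> insert z S" for y
  proof (cases "y = z")
    case True
    then show ?thesis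
      using q by (intro exI[of _ "d * m"]) simp
  next
    case False
    then obtain k where "of_int k = of_int d * f y"
      using y d by blast
    then show ?thesis
      by (intro exI[of _ "n * k"]) simp
  qed
  then show ?case
    using d q by (intro exI[of _ "d * n"]) simp
qed (auto intro: exI[of _ 1])

section \<open>Linear inequalities in a complete theory\<close>

definition terms_over :: "nat set set \<Rightarrow> (pfm \<times> nat set) set" where
  "terms_over \<V> = {(\<phi>, V). finite V \<and> pvars \<phi> \<subseteq> V \<and> (\<exists>V'\<in>\<V>. V \<subseteq> V')}"

lemma Geq_wff [simp]: "Geq t c \<in> wff \<V> \<longleftrightarrow> snd ` set t \<subseteq> terms_over \<V>"
proof -
  have "Geq t c \<in> wff \<V> \<longleftrightarrow>
      (\<forall>(a, \<phi>, V)\<in>set t. finite V \<and> pvars \<phi> \<subseteq> V \<and> (\<exists>V'\<in>\<V>. V \<subseteq> V'))"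
    by (simp add: wff_def fam_le_def split_beta) blast
  then show ?thesis
    by (simp add: terms_over_def split_beta image_subset_iff)
qed

definition coef :: "qterm \<Rightarrow> pfm \<times> nat set \<Rightarrow> int" where
  "coef t y = (\<Sum>(a, z)\<leftarrow>t. if z = y then a else 0)"

lemma coef_simps [simp]:
  "coef [] y = 0" "coef ((a, z) # t) y = (if z = y then a else 0) + coef t y"
  by (simp_all add: coef_def)

lemma coef_eq_0: "y \<notin> snd ` set t \<Longrightarrow> coef t y = 0"
  by (induction t) auto

lemma lin_eq_sum_coef:
  assumes "snd ` set t \<subseteq> S" "finite S"
  shows "lin x t = (\<Sum>y\<in>S. of_int (coef t y) * case_prod x y)"
  using assms(1)
proof (induction t)
  case (Cons p t)
  obtain a z where p: "p = (a, z)"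
    by (cases p)
  have z: "z \<in> S"
    using Cons.prems p by simp
  have "(\<Sum>y\<in>S. of_int (coef (p # t) y) * case_prod x y) =
      (\<Sum>y\<in>S. (if z = y then of_int a * case_prod x y else 0) + of_int (coef t y) * case_prod x y)"
    by (intro sum.cong) (auto simp: p algebra_simps)
  also have "\<dots> = of_int a * case_prod x z + lin x t"
    using Cons z assms(2) by (simp add: sum.distrib sum.delta)
  finally show ?case
    by (cases z) (simp add: p)
qed simp

section \<open>Arithmetic of inequalities derived inside \<open>T\<close>\<close>

context complete_theory
begin

lemma subset_wff: "\<beta> \<in> T \<Longrightarrow> \<beta> \<in> wff \<V>"
  using thy by (auto simp: qtl_theory_def)

lemma axiom_mem: "qtl_axiom \<beta> \<Longrightarrow> \<beta> \<in> wff \<V> \<Longrightarrow> \<beta> \<in> T"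
  using thy theorems_axiom by (auto simp: qtl_theory_def)

lemma mp_mem: "Imp \<alpha> \<beta> \<in> T \<Longrightarrow> \<alpha> \<in> T \<Longrightarrow> \<beta> \<in> T"
  using thy unfolding qtl_theory_def by blast

lemma rule_Imp_mem: "qtl_rule \<V> \<alpha> \<beta> \<Longrightarrow> \<alpha> \<in> wff \<V> \<Longrightarrow> \<beta> \<in> wff \<V> \<Longrightarrow> Imp \<alpha> \<beta> \<in> T"
  using thy theorems_rule unfolding qtl_theory_def by blast

lemma rule_mem: "qtl_rule \<V> \<alpha> \<beta> \<Longrightarrow> \<alpha> \<in> T \<Longrightarrow> \<beta> \<in> wff \<V> \<Longrightarrow> \<beta> \<in> T"
  using rule_Imp_mem mp_mem subset_wff by blast

lemma taut_mem: "tautology \<beta> \<Longrightarrow> \<beta> \<in> wff \<V> \<Longrightarrow> \<beta> \<in> T"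
  by (simp add: axiom_mem qtl_axiom.taut)

lemma Conj_iff:
  assumes "\<alpha> \<in> wff \<V>" "\<beta> \<in> wff \<V>"
  shows "Conj \<alpha> \<beta> \<in> T \<longleftrightarrow> \<alpha> \<in> T \<and> \<beta> \<in> T"
proof -
  have "Imp (Conj \<alpha> \<beta>) \<alpha> \<in> T" "Imp (Conj \<alpha> \<beta>) \<beta> \<in> T" "Imp \<alpha> (Imp \<beta> (Conj \<alpha> \<beta>)) \<in> T"
    using assms by (auto intro!: taut_mem simp: tautology_def)
  then show ?thesis
    using mp_mem by blast
qed

lemma mset_mem_iff:
  assumes "mset t = mset t'"
  shows "Geq t c \<in> T \<longleftrightarrow> Geq t' c \<in> T"
proof -
  have "Geq t' c \<in> T" if eq: "mset t = mset t'" and mem: "Geq t c \<in> T" for t t'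
  proof -
    obtain \<sigma> where \<sigma>: "\<sigma> permutes {..<length t}" "permute_list \<sigma> t = t'"
      using mset_eq_permutation[OF eq[symmetric]] by blast
    have "set t = set t'"
      using eq mset_eq_setD by blast
    then show ?thesis
      using rule_mem[OF qtl_rule.perm_intro[OF \<sigma>(1)] mem] subset_wff[OF mem] \<sigma>(2) by auto
  qed
  then show ?thesis
    using assms by metis
qed

lemma zeros_mem_iff:
  assumes "set ys \<subseteq> terms_over \<V>"
  shows "Geq (t @ map (Pair 0) ys) c \<in> T \<longleftrightarrow> Geq t c \<in> T"
  using assms
proof (induction ys rule: rev_induct)
  case (snoc y ys)
  obtain \<phi> V where y: "y = (\<phi>, V)"
    by (cases y)
  let ?t = "t @ map (Pair 0) ys"
  have "Geq (?t @ [(0, \<phi>, V)]) c \<in> T \<longleftrightarrow> Geq ?t c \<in> T"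
  proof
    assume mem: "Geq (?t @ [(0, \<phi>, V)]) c \<in> T"
    show "Geq ?t c \<in> T"
      using subset_wff[OF mem] by (intro rule_mem[OF qtl_rule.zero_elim mem]) auto
  next
    assume mem: "Geq ?t c \<in> T"
    show "Geq (?t @ [(0, \<phi>, V)]) c \<in> T"
      using subset_wff[OF mem] snoc.prems y by (intro rule_mem[OF qtl_rule.zero_intro mem]) auto
  qed
  then show ?case
    using snoc y by simp
qed simp

lemma total_mem:
  assumes "snd ` set t \<subseteq> terms_over \<V>"
  shows "Geq t c \<in> T \<or> Geq (tscale (-1) t) (- c) \<in> T"
proof -
  have w: "Geq t c \<in> wff \<V>" "Geq (tscale (-1) t) (- c) \<in> wff \<V>"
    using assms by (auto simp: tscale_def image_image split_beta)
  then have "Disj (Geq t c) (Leq t c) \<in> T"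
    by (intro axiom_mem qtl_axiom.linear) (auto simp: Disj_def Leq_def)
  then show ?thesis
    using w Conj_iff Neg_iff unfolding Disj_def Leq_def by (metis wff_simps(1,2))
qed

lemma Geq_Nil_0: "Geq [] 0 \<in> T"
  using total_mem[of "[]" 0] by simp

text \<open>Consistency of the arithmetic: the rule \<open>strict\<close> turns 0 \<ge> c with c > 0
  into 0 > 0, the negation of a member of \<open>T\<close>.\<close>

lemma Geq_Nil_pos: "c > 0 \<Longrightarrow> Geq [] c \<notin> T"
proof
  assume "c > 0" "Geq [] c \<in> T"
  then have "Greater [] 0 \<in> T"
    using rule_mem[OF qtl_rule.strict[where t = "[]" and c = c and d = 0]]
    by (auto simp: Greater_def Leq_def)
  then show False
    using Geq_Nil_0 Neg_iff[of "Geq [] 0"] by (auto simp: Greater_def Leq_def)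
qed

lemma scale_mem_iff:
  assumes "d > 0"
  shows "Geq (tscale d t) (d * c) \<in> T \<longleftrightarrow> Geq t c \<in> T"
proof
  assume mem: "Geq (tscale d t) (d * c) \<in> T"
  show "Geq t c \<in> T"
    using subset_wff[OF mem]
    by (intro rule_mem[OF qtl_rule.scale_elim[OF assms] mem]) (auto simp: tscale_def image_image split_beta)
next
  assume mem: "Geq t c \<in> T"
  show "Geq (tscale d t) (d * c) \<in> T"
    using subset_wff[OF mem]
    by (intro rule_mem[OF qtl_rule.scale_intro[OF assms] mem]) (auto simp: tscale_def image_image split_beta)
qed

lemma add_mem:
  assumes "Geq (map (\<lambda>(a, b, y). (a, y)) ts) c \<in> T" "Geq (map (\<lambda>(a, b, y). (b, y)) ts) d \<in> T"
  shows "Geq (map (\<lambda>(a, b, y). (a + b, y)) ts) (c + d) \<in> T"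
proof (rule rule_mem[OF qtl_rule.add])
  show "Conj (Geq (map (\<lambda>(a, b, y). (a, y)) ts) c) (Geq (map (\<lambda>(a, b, y). (b, y)) ts) d) \<in> T"
    using assms subset_wff Conj_iff by blast
  show "Geq (map (\<lambda>(a, b, y). (a + b, y)) ts) (c + d) \<in> wff \<V>"
    using subset_wff[OF assms(1)] by (auto simp: image_image split_beta)
qed

text \<open>The axiom \<open>refl\<close> covers a = 1. Scaling reaches a > 0, exchanging the two
  summands reaches a < 0, and for a = 0 zero terms are appended to the empty sum.\<close>

lemma cancel_mem:
  assumes "y \<in> terms_over \<V>"
  shows "Geq [(a, y), (- a, y)] 0 \<in> T"
proof -
  obtain \<phi> V where y: "y = (\<phi>, V)"
    by (cases y)
  have "GeqT [(1, \<phi>, V)] [(1, \<phi>, V)] \<in> T"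
    using assms y by (intro axiom_mem qtl_axiom.refl) (auto simp: GeqT_def tminus_def)
  then have one: "Geq [(1, y), (- 1, y)] 0 \<in> T"
    by (simp add: GeqT_def tminus_def y)
  then have pos: "Geq [(b, y), (- b, y)] 0 \<in> T" if "b > 0" for b
    using scale_mem_iff[OF that, of "[(1, y), (- 1, y)]" 0] by simp
  show ?thesis
  proof (cases a "0 :: int" rule: linorder_cases)
    case less
    then show ?thesis
      using pos[of "- a"] mset_mem_iff[of "[(- a, y), (a, y)]" "[(a, y), (- a, y)]"] by simp
  next
    case equal
    then show ?thesis
      using zeros_mem_iff[of "[y, y]" "[]" 0] assms Geq_Nil_0 by simp
  qed (simp add: pos)
qed

text \<open>The rule \<open>add\<close> works position by position and never merges two occurrences
  of a term by itself. Adding a cancelling pair with coefficients b and -b, padded by zeros, moves b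
  from the second occurrence to the first; the opposite pair moves it back.\<close>

lemma merge_mem_iff:
  assumes "y \<in> terms_over \<V>" "snd ` set t \<subseteq> terms_over \<V>"
  shows "Geq ((a, y) # (b, y) # t) c \<in> T \<longleftrightarrow> Geq ((a + b, y) # t) c \<in> T"
proof -
  let ?zip = "map (\<lambda>(k, z). (k, 0, z)) t"
  have cancel: "Geq ([(k, y), (- k, y)] @ map (Pair 0) (map snd t)) 0 \<in> T" for k
    using cancel_mem[OF assms(1)] assms(2) by (subst zeros_mem_iff) auto
  have zip: "map (\<lambda>(a, b, y). (a, y)) ?zip = t" "map (\<lambda>(a, b, y). (b, y)) ?zip = map (Pair 0) (map snd t)"
      "map (\<lambda>(a, b, y). (a + b, y)) ?zip = t"
    by (simp_all add: split_beta comp_def)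
  have zero: "Geq ((a + b, y) # (0, y) # t) c \<in> T \<longleftrightarrow> Geq ((a + b, y) # t) c \<in> T"
    using zeros_mem_iff[of "[y]" "(a + b, y) # t"] assms
      mset_mem_iff[of "(a + b, y) # (0, y) # t" "((a + b, y) # t) @ [(0, y)]"] by simp
  show ?thesis
    unfolding zero[symmetric]
  proof
    assume "Geq ((a, y) # (b, y) # t) c \<in> T"
    then show "Geq ((a + b, y) # (0, y) # t) c \<in> T"
      using add_mem[of "(a, b, y) # (b, - b, y) # ?zip" c 0, unfolded list.map(2) prod.case zip] cancel[of b]
      by simp
  next
    assume "Geq ((a + b, y) # (0, y) # t) c \<in> T"
    then show "Geq ((a, y) # (b, y) # t) c \<in> T"
      using add_mem[of "(a + b, - b, y) # (0, b, y) # ?zip" c 0, unfolded list.map(2) prod.case zip]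
        cancel[of "- b"] by simp
  qed
qed

section \<open>Normal forms over a fixed list of terms, and the preorder on rational forms\<close>

abbreviation canon :: "(pfm \<times> nat set) list \<Rightarrow> (pfm \<times> nat set \<Rightarrow> int) \<Rightarrow> qterm" where
  "canon ys f \<equiv> map (\<lambda>y. (f y, y)) ys"

text \<open>The coefficients \<open>f\<close> act as an accumulator: each summand of
  \<open>t\<close> is merged into the entry of \<open>ys\<close> with the same term.\<close>

lemma collect_mem_iff:
  assumes "distinct ys" "set ys \<subseteq> terms_over \<V>" "snd ` set t \<subseteq> set ys"
  shows "Geq (t @ canon ys f) c \<in> T \<longleftrightarrow> Geq (canon ys (\<lambda>y. f y + coef t y)) c \<in> T"
  using assms(3)
proof (induction t arbitrary: f)
  case (Cons p t)
  obtain a z where p: "p = (a, z)"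
    by (cases p)
  then have z: "z \<in> set ys"
    using Cons.prems by simp
  then obtain ys1 ys2 where ys: "ys = ys1 @ z # ys2"
    by (meson split_list)
  let ?f = "f(z := a + f z)"
  let ?r = "t @ canon ys1 f @ canon ys2 f"
  have "Geq ((p # t) @ canon ys f) c \<in> T \<longleftrightarrow> Geq ((a, z) # (f z, z) # ?r) c \<in> T"
    by (rule mset_mem_iff) (simp add: ys p)
  also have "\<dots> \<longleftrightarrow> Geq ((a + f z, z) # ?r) c \<in> T"
    using assms(2) z Cons.prems ys by (intro merge_mem_iff) auto
  also have "\<dots> \<longleftrightarrow> Geq (t @ canon ys ?f) c \<in> T"
  proof -
    have "z \<notin> set ys1" "z \<notin> set ys2"
      using assms(1) ys by auto
    then have "canon ys ?f = canon ys1 f @ (a + f z, z) # canon ys2 f"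
      using ys by auto
    then show ?thesis
      by (intro mset_mem_iff) (simp del: fun_upd_apply)
  qed
  also have "\<dots> \<longleftrightarrow> Geq (canon ys (\<lambda>y. ?f y + coef t y)) c \<in> T"
    using Cons by simp
  also have "(\<lambda>y. ?f y + coef t y) = (\<lambda>y. f y + coef (p # t) y)"
    by (auto simp: p)
  finally show ?case .
qed simp

lemma canon_mem_iff:
  assumes "distinct ys" "set ys \<subseteq> terms_over \<V>" "snd ` set t \<subseteq> set ys"
  shows "Geq t c \<in> T \<longleftrightarrow> Geq (canon ys (coef t)) c \<in> T"
  using zeros_mem_iff[OF assms(2), of t c] collect_mem_iff[OF assms, of "\<lambda>_. 0" c] by simp

lemma canon_add:
  assumes "Geq (canon ys f) c \<in> T" "Geq (canon ys g) d \<in> T"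
  shows "Geq (canon ys (\<lambda>y. f y + g y)) (c + d) \<in> T"
  using add_mem[of "map (\<lambda>y. (f y, g y, y)) ys" c d] assms by (simp add: comp_def)

lemma canon_scale: "d > 0 \<Longrightarrow> Geq (canon ys (\<lambda>y. d * f y)) (d * c) \<in> T \<longleftrightarrow> Geq (canon ys f) c \<in> T"
  using scale_mem_iff[of d "canon ys f" c] by (simp add: tscale_def comp_def)

text \<open>This is the predicate to which \<open>cone_point\<close> is applied. The index
  \<open>None\<close> carries the constant term, which changes sign because c stands on the right of
  an inequality. The factor d clears denominators; since scaling is reversible in \<open>T\<close>,
  its choice is immaterial.\<close>

definition nonneg :: "(pfm \<times> nat set) list \<Rightarrow> ((pfm \<times> nat set) option \<Rightarrow> rat) \<Rightarrow> bool" where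
  "nonneg ys f \<longleftrightarrow> (\<exists>d>0. \<exists>a c. (\<forall>y\<in>set ys. of_int (a y) = of_int d * f (Some y)) \<and>
     of_int c = - (of_int d * f None) \<and> Geq (canon ys a) c \<in> T)"

lemma nonnegE:
  assumes "nonneg ys f"
  obtains d a c where "d > 0" "\<forall>y\<in>set ys. of_int (a y) = of_int d * f (Some y)"
    "of_int c = - (of_int d * f None)" "Geq (canon ys a) c \<in> T"
  using assms unfolding nonneg_def by blast

lemma nonneg_add:
  assumes "nonneg ys f" "nonneg ys g"
  shows "nonneg ys (\<lambda>i. f i + g i)"
proof -
  obtain d a c where 1: "d > 0" "\<forall>y\<in>set ys. of_int (a y) = of_int d * f (Some y)"
      "of_int c = - (of_int d * f None)" "Geq (canon ys a) c \<in> T"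
    using assms(1) by (rule nonnegE) blast
  obtain d' a' c' where 2: "d' > 0" "\<forall>y\<in>set ys. of_int (a' y) = of_int d' * g (Some y)"
      "of_int c' = - (of_int d' * g None)" "Geq (canon ys a') c' \<in> T"
    using assms(2) by (rule nonnegE) blast
  have "Geq (canon ys (\<lambda>y. d' * a y + d * a' y)) (d' * c + d * c') \<in> T"
    using 1 2 by (intro canon_add) (simp_all add: canon_scale)
  then show ?thesis
    unfolding nonneg_def using 1 2
    by (intro exI[of _ "d * d'"] conjI exI[of _ "\<lambda>y. d' * a y + d * a' y"] exI[of _ "d' * c + d * c'"])
      (auto simp: algebra_simps)
qed

lemma nonneg_scale:
  assumes "q > 0" "nonneg ys f"
  shows "nonneg ys (\<lambda>i. q * f i)"
proof -
  obtain d a c where 1: "d > 0" "\<forall>y\<in>set ys. of_int (a y) = of_int d * f (Some y)"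
      "of_int c = - (of_int d * f None)" "Geq (canon ys a) c \<in> T"
    using assms(2) by (rule nonnegE) blast
  obtain m n :: int where q: "q = of_int m / of_int n" "n > 0"
    by (cases q) (auto simp: Fract_of_int_quotient)
  then have "m > 0"
    using assms(1) by (simp add: zero_less_divide_iff)
  then have "Geq (canon ys (\<lambda>y. m * a y)) (m * c) \<in> T"
    using 1 by (simp add: canon_scale)
  then show ?thesis
    unfolding nonneg_def using 1 q
    by (intro exI[of _ "d * n"] conjI exI[of _ "\<lambda>y. m * a y"] exI[of _ "m * c"]) auto
qed

lemma nonneg_total:
  assumes "set ys \<subseteq> terms_over \<V>"
  shows "nonneg ys f \<or> nonneg ys (\<lambda>i. - f i)"
proof -
  obtain d where d: "d > 0" "\<forall>y\<in>insert None (Some ` set ys). \<exists>k. of_int k = of_int d * f y"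
    using common_denominator[of "insert None (Some ` set ys)" f] by auto
  then obtain k where k: "\<And>i. i \<in> insert None (Some ` set ys) \<Longrightarrow> of_int (k i) = of_int d * f i"
    by metis
  have "Geq (canon ys (k \<circ> Some)) (- k None) \<in> T \<or> Geq (canon ys (\<lambda>y. - k (Some y))) (k None) \<in> T"
    using total_mem[of "canon ys (k \<circ> Some)" "- k None"] assms
    by (auto simp: tscale_def image_image comp_def)
  then show ?thesis
  proof
    assume "Geq (canon ys (k \<circ> Some)) (- k None) \<in> T"
    then have "nonneg ys f"
      unfolding nonneg_def using d k
      by (intro exI[of _ d] conjI exI[of _ "k \<circ> Some"] exI[of _ "- k None"]) auto
    then show ?thesis ..
  next
    assume "Geq (canon ys (\<lambda>y. - k (Some y))) (k None) \<in> T"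
    then have "nonneg ys (\<lambda>i. - f i)"
      unfolding nonneg_def using d k
      by (intro exI[of _ d] conjI exI[of _ "\<lambda>y. - k (Some y)"] exI[of _ "k None"]) auto
    then show ?thesis ..
  qed
qed

text \<open>After clearing denominators, -1 \<ge> 0 says that a sum with zero coefficients is at
  least d > 0; deleting the zero terms contradicts \<open>Geq_Nil_pos\<close>.\<close>

lemma not_nonneg_unit:
  assumes "set ys \<subseteq> terms_over \<V>"
  shows "\<not> nonneg ys (\<lambda>i. - of_bool (i = None))"
proof
  assume "nonneg ys (\<lambda>i. - of_bool (i = None))"
  then obtain d a c where d: "d > 0" "\<And>y. y \<in> set ys \<Longrightarrow> of_int (a y) = (0 :: rat)"
    "of_int c = (of_int d :: rat)" "Geq (canon ys a) c \<in> T"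
    unfolding nonneg_def by auto
  then have "canon ys a = [] @ map (Pair 0) ys" "c = d"
    by auto
  then show False
    using d(1,4) zeros_mem_iff[OF assms, of "[]" d] Geq_Nil_pos by metis
qed

lemma nonneg_iff:
  "nonneg ys (case_option (- of_int c) (\<lambda>y. of_int (a y))) \<longleftrightarrow> Geq (canon ys a) c \<in> T"
proof
  assume "nonneg ys (case_option (- of_int c) (\<lambda>y. of_int (a y)))"
  then obtain d a' c' where d: "d > 0"
      "\<And>y. y \<in> set ys \<Longrightarrow> of_int (a' y) = (of_int d * of_int (a y) :: rat)"
      "of_int c' = (of_int d * of_int c :: rat)" "Geq (canon ys a') c' \<in> T"
    unfolding nonneg_def by auto
  then have "c' = d * c" "canon ys a' = canon ys (\<lambda>y. d * a y)"
    by (auto simp flip: of_int_mult)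
  then show "Geq (canon ys a) c \<in> T"
    using d(4) canon_scale[OF d(1), of a ys c] by (simp only:)
next
  assume "Geq (canon ys a) c \<in> T"
  then show "nonneg ys (case_option (- of_int c) (\<lambda>y. of_int (a y)))"
    unfolding nonneg_def by (intro exI[of _ 1] conjI exI[of _ a] exI[of _ c]) auto
qed

end

fun atoms :: "qfm \<Rightarrow> (qterm \<times> int) set" where
  "atoms (Geq t c) = {(t, c)}"
| "atoms (Neg \<alpha>) = atoms \<alpha>"
| "atoms (Conj \<alpha> \<beta>) = atoms \<alpha> \<union> atoms \<beta>"

lemma finite_atoms: "finite (atoms \<beta>)"
  by (induction \<beta>) auto

lemma wff_iff_atoms: "\<beta> \<in> wff \<V> \<longleftrightarrow> (\<forall>(t, c)\<in>atoms \<beta>. snd ` set t \<subseteq> terms_over \<V>)"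
  by (induction \<beta>) (simp_all add: ball_Un)

text \<open>It suffices to agree with \<open>T\<close> on the atoms, because \<open>Neg_iff\<close>
  and \<open>Conj_iff\<close> make \<open>T\<close> behave like a valuation. The atoms of \<Delta>
  give finitely many forms in finitely many unknowns, to which \<open>cone_point\<close>
  applies.\<close>

lemma (in complete_theory) finite_model:
  assumes "finite \<Delta>" "\<Delta> \<subseteq> wff \<V>"
  obtains x :: "pfm \<Rightarrow> nat set \<Rightarrow> rat" where "\<And>\<beta>. \<beta> \<in> \<Delta> \<Longrightarrow> \<beta> \<in> T \<longleftrightarrow> models x \<beta>"
proof -
  let ?A = "\<Union>(atoms ` \<Delta>)"
  let ?Y = "\<Union>(t, c)\<in>?A. snd ` set t"
  have finA: "finite ?A"
    using assms(1) finite_atoms by blast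
  then have "finite ?Y"
    by (rule finite_UN_I) auto
  then obtain ys where ys: "set ys = ?Y" "distinct ys"
    using finite_distinct_list[OF \<open>finite ?Y\<close>] by blast
  have over: "set ys \<subseteq> terms_over \<V>"
    using assms(2) wff_iff_atoms unfolding ys by fast
  \<comment> \<open>With the coordinate \<open>None\<close> of the point fixed at 1, the form
    evaluates to the value of t minus c.\<close>
  define h where "h = (\<lambda>(t, c). case_option (- of_int c) (\<lambda>y. of_int (coef t y)) :: (pfm \<times> nat set) option \<Rightarrow> rat)"
  have "\<exists>x. x None = 1 \<and> (\<forall>f\<in>h ` ?A. nonneg ys f \<longleftrightarrow> 0 \<le> (\<Sum>i\<in>insert None (Some ` set ys). f i * x i))"
  proof (rule cone_point)
    show "f i = 0" if "f \<in> h ` ?A" "i \<notin> insert None (Some ` set ys)" for f i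
    proof -
      obtain t c where tc: "(t, c) \<in> ?A" "f = h (t, c)"
        using \<open>f \<in> h ` ?A\<close> by auto
      then have "snd ` set t \<subseteq> set ys"
        using ys by blast
      moreover obtain y where "i = Some y" "y \<notin> set ys"
        using \<open>i \<notin> _\<close> by (cases i) auto
      ultimately show ?thesis
        using coef_eq_0[of y t] tc(2) by (auto simp: h_def)
    qed
  qed (use finA nonneg_add nonneg_scale nonneg_total[OF over] not_nonneg_unit[OF over] in auto)
  then obtain x where x: "x None = 1"
      "\<And>f. f \<in> h ` ?A \<Longrightarrow> nonneg ys f \<longleftrightarrow> 0 \<le> (\<Sum>i\<in>insert None (Some ` set ys). f i * x i)"
    by blast
  define x' where "x' = (\<lambda>\<phi> V. x (Some (\<phi>, V)))"
  have atom: "Geq t c \<in> T \<longleftrightarrow> models x' (Geq t c)" if tc: "(t, c) \<in> ?A" for t c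
  proof -
    have sub: "snd ` set t \<subseteq> set ys"
      using tc ys by blast
    have "Geq t c \<in> T \<longleftrightarrow> nonneg ys (h (t, c))"
      using canon_mem_iff[OF ys(2) over sub] by (simp add: h_def nonneg_iff)
    also have "\<dots> \<longleftrightarrow> 0 \<le> (\<Sum>i\<in>insert None (Some ` set ys). h (t, c) i * x i)"
      using x(2) tc by blast
    also have "(\<Sum>i\<in>insert None (Some ` set ys). h (t, c) i * x i) = lin x' t - of_int c"
      by (simp add: lin_eq_sum_coef[OF sub] sum.reindex h_def x(1) x'_def split_beta)
    finally show ?thesis
      by simp
  qed
  have "\<beta> \<in> T \<longleftrightarrow> models x' \<beta>" if "atoms \<beta> \<subseteq> ?A" "\<beta> \<in> wff \<V>" for \<beta>
    using that
  proof (induction \<beta>)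
    case (Geq t c)
    then show ?case
      using atom by simp
  qed (simp_all add: Neg_iff Conj_iff)
  then show ?thesis
    using that[of x'] assms(2) by blast
qed

section \<open>Teams with prescribed probabilities\<close>

lemma peval_cong: "(\<And>p. p \<in> pvars \<phi> \<Longrightarrow> v p = v' p) \<Longrightarrow> peval v \<phi> = peval v' \<phi>"
  by (induction \<phi>) auto

text \<open>An assignment is the set of its true symbols. A pair (V, s') is a possible kind of team
  member with domain V; collected are those counted over U whose restriction to U is s.\<close>

definition states_above :: "nat set set \<Rightarrow> nat set \<Rightarrow> nat set \<Rightarrow> (nat set \<times> nat set) set" where
  "states_above \<V> U s = {(V, s'). V \<in> \<V> \<and> U \<subseteq> V \<and> s' \<subseteq> V \<and> s' \<inter> U = s}"

lemma finite_states_above: "finite \<V> \<Longrightarrow> (\<And>V. V \<in> \<V> \<Longrightarrow> finite V) \<Longrightarrow> finite (states_above \<V> U s)"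
  by (rule finite_subset[of _ "Sigma \<V> Pow"]) (auto simp: states_above_def)

text \<open>The sets of \<open>\<V>\<close> are treated in order of decreasing size. A new set \<open>U\<close> has no subset among
  the old ones, so new points with domain \<open>U\<close> only affect the counts at \<open>U\<close>. They can correct the
  counts inherited from the supersets of \<open>U\<close> as soon as the common factor \<open>K U\<close> is large, because
  nothing is inherited at an \<open>s\<close> of weight \<open>0\<close>.\<close>

lemma counts_exist:
  fixes w :: "nat set \<Rightarrow> nat set \<Rightarrow> rat"
  assumes "finite \<V>" "\<And>V. V \<in> \<V> \<Longrightarrow> finite V"
    and "\<And>V s. V \<in> \<V> \<Longrightarrow> s \<subseteq> V \<Longrightarrow> 0 \<le> w V s"
    and "\<And>U V s. U \<in> \<V> \<Longrightarrow> V \<in> \<V> \<Longrightarrow> U \<subseteq> V \<Longrightarrow> s \<subseteq> V \<Longrightarrow> w U (s \<inter> U) = 0 \<Longrightarrow> w V s = 0"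
  shows "\<exists>n K. \<forall>U\<in>\<V>. K U > 0 \<and>
    (\<forall>s. s \<subseteq> U \<longrightarrow> of_nat (\<Sum>i\<in>states_above \<V> U s. n i) = of_nat (K U :: nat) * w U s)"
  using assms
\<comment> \<open>The element inserted last has the largest rank; the minus sign makes it the set of
  least cardinality.\<close>
proof (induction \<V> rule: finite_ranking_induct[where f = "\<lambda>V. - int (card V)"])
  case empty
  then show ?case
    by simp
next
  case (insert U S)
  have fin: "\<And>V. V \<in> S \<Longrightarrow> finite V" "finite U"
    using insert.prems(1) by auto
  have IH: "\<exists>n K. \<forall>V\<in>S. K V > 0 \<and>
    (\<forall>s. s \<subseteq> V \<longrightarrow> of_nat (\<Sum>i\<in>states_above S V s. n i) = of_nat (K V :: nat) * w V s)"
  proof (rule insert.IH)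
    show "w V s = 0" if "U' \<in> S" "V \<in> S" "U' \<subseteq> V" "s \<subseteq> V" "w U' (s \<inter> U') = 0" for U' V s
      using insert.prems(3)[of U' V s] that by blast
  qed (use insert.prems(1,2) in auto)
  show ?case
  proof (cases "U \<in> S")
    case True
    then show ?thesis
      using IH by (simp only: insert_absorb)
  next
    case new: False
    obtain n K where IH: "\<And>V. V \<in> S \<Longrightarrow> K V > 0"
        "\<And>V s. V \<in> S \<Longrightarrow> s \<subseteq> V \<Longrightarrow> of_nat (\<Sum>i\<in>states_above S V s. n i) = of_nat (K V :: nat) * w V s"
      using IH by metis
    define R where "R s = (\<Sum>i\<in>states_above S U s. n i)" for s
    \<comment> \<open>An inherited point (V, s') makes the count at V and s' nonzero, hence also the
      weight there; by compatibility its restriction to U has nonzero weight.\<close>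
    have R0: "R s = 0" if s: "s \<subseteq> U" "w U s = 0" for s
      unfolding R_def
    proof (rule sum.neutral, rule ballI, rule ccontr)
      fix i assume i: "i \<in> states_above S U s" "n i \<noteq> 0"
      then obtain V s' where V: "i = (V, s')" "V \<in> S" "U \<subseteq> V" "s' \<subseteq> V" "s' \<inter> U = s"
        by (auto simp: states_above_def)
      then have "i \<in> states_above S V s'"
        by (auto simp: states_above_def)
      then have "(\<Sum>i\<in>states_above S V s'. n i) \<noteq> 0"
        using i(2) finite_states_above[of S V s'] insert.hyps(1) fin by auto
      then have "w V s' \<noteq> 0"
        using IH(2)[OF V(2,4)] by (metis mult_zero_right of_nat_eq_0_iff)
      then show False
        using insert.prems(3)[of U V s'] V s by auto
    qed
    obtain D where D: "D > 0" "\<forall>s\<in>Pow U. \<exists>k. of_int k = of_int D * w U s"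
      using common_denominator[of "Pow U" "w U"] fin(2) by auto
    then obtain k where k: "\<And>s. s \<subseteq> U \<Longrightarrow> of_int (k s) = of_int D * w U s"
      by (metis PowI)
    \<comment> \<open>A nonzero \<open>k s\<close> is at least 1, so a multiplier exceeding every
      inherited count makes the targets dominate those counts. The summand 1 keeps the new factor
      positive.\<close>
    define M where "M = 1 + (\<Sum>s\<in>Pow U. R s)"
    have kM: "int (R s) \<le> k s * int M" if s: "s \<subseteq> U" for s
    proof (cases "w U s = 0")
      case True
      then show ?thesis
        using R0[OF s] k[OF s] by simp
    next
      case False
      then have "(0 :: rat) < of_int (k s)"
        using k[OF s] insert.prems(2)[of U s] s D(1) by simp
      then have "1 * int M \<le> k s * int M"
        by (intro mult_right_mono) auto
      moreover have "R s \<le> (\<Sum>s\<in>Pow U. R s)"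
        using s fin(2) by (intro member_le_sum) auto
      then have "R s \<le> M"
        by (simp add: M_def)
      ultimately show ?thesis
        by linarith
    qed
    \<comment> \<open>The new points with domain U make up the difference between target and
      inherited count; by \<open>kM\<close> the conversion \<open>nat\<close> truncates
      nothing.\<close>
    define n' where "n' = (\<lambda>(V, s). if V = U then nat (k s * int M - int (R s)) else n (V, s))"
    have same: "(\<Sum>i\<in>states_above S V s. n' i) = (\<Sum>i\<in>states_above S V s. n i)" for V s
      using new by (intro sum.cong) (auto simp: states_above_def n'_def)
    have old: "states_above (insert U S) V s = states_above S V s" if "V \<in> S" for V s
    proof -
      have "\<not> V \<subseteq> U"
      proof
        assume "V \<subseteq> U"
        moreover have "card U \<le> card V"
          using insert.hyps(2)[OF that] by simp
        ultimately have "V = U"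
          using card_seteq fin(2) by blast
        with new that show False
          by simp
      qed
      then show ?thesis
        by (auto simp: states_above_def)
    qed
    have "states_above (insert U S) U s = insert (U, s) (states_above S U s)" if "s \<subseteq> U" for s
      using that by (auto simp: states_above_def)
    moreover have "(U, s) \<notin> states_above S U s" "finite (states_above S U s)" for s
      using new finite_states_above[of S U s] insert.hyps(1) fin by (auto simp: states_above_def)
    ultimately have "int (\<Sum>i\<in>states_above (insert U S) U s. n' i) = k s * int M" if "s \<subseteq> U" for s
      using kM[OF that] that by (simp add: same flip: R_def) (simp add: n'_def)
    then have "rat_of_int (int (\<Sum>i\<in>states_above (insert U S) U s. n' i)) = of_nat (nat D * M) * w U s"
      if "s \<subseteq> U" for s
      using that k[OF that] D(1) by simp
    then have at_U: "of_nat (\<Sum>i\<in>states_above (insert U S) U s. n' i) = of_nat (nat D * M) * w U s"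
      if "s \<subseteq> U" for s
      using that by simp
    have at_old: "of_nat (\<Sum>i\<in>states_above (insert U S) V s. n' i) = of_nat (K V) * w V s"
      if "V \<in> S" "s \<subseteq> V" for V s
      using IH(2)[OF that] by (simp only: old[OF that(1)] same)
    have "nat D * M > 0"
      using D(1) by (simp add: M_def)
    then show ?thesis
      using at_U at_old IH(1) new
      by (intro exI[of _ n'] exI[of _ "K(U := nat D * M)"]) (auto simp del: of_nat_sum of_nat_mult)
  qed
qed

lemma weights_realized:
  fixes w :: "nat set \<Rightarrow> nat set \<Rightarrow> rat"
  assumes fin: "finite \<V>" "\<And>V. V \<in> \<V> \<Longrightarrow> finite V" and ne: "{} \<notin> \<V>"
    and nonneg: "\<And>V s. V \<in> \<V> \<Longrightarrow> s \<subseteq> V \<Longrightarrow> 0 \<le> w V s"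
    and total: "\<And>V. V \<in> \<V> \<Longrightarrow> (\<Sum>s\<in>Pow V. w V s) = 1"
    and compat: "\<And>U V s. U \<in> \<V> \<Longrightarrow> V \<in> \<V> \<Longrightarrow> U \<subseteq> V \<Longrightarrow> s \<subseteq> V \<Longrightarrow> w U (s \<inter> U) = 0 \<Longrightarrow> w V s = 0"
  obtains X :: "((nat set \<times> nat set) \<times> nat) team" where "quantum_team X" "fam_le \<V> (team_supp X)"
    "\<And>U \<phi>. U \<in> \<V> \<Longrightarrow> pvars \<phi> \<subseteq> U \<Longrightarrow>
      team_prob X U \<phi> = of_rat (\<Sum>s\<in>{s \<in> Pow U. peval (\<lambda>p. p \<in> s) \<phi>}. w U s)"
proof -
  have "\<exists>n K. \<forall>U\<in>\<V>. K U > 0 \<and>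
    (\<forall>s. s \<subseteq> U \<longrightarrow> of_nat (\<Sum>i\<in>states_above \<V> U s. n i) = of_nat (K U :: nat) * w U s)"
    by (rule counts_exist[OF fin nonneg compat])
  then obtain n K where K: "\<And>U. U \<in> \<V> \<Longrightarrow> K U > 0"
      "\<And>U s. U \<in> \<V> \<Longrightarrow> s \<subseteq> U \<Longrightarrow> of_nat (\<Sum>i\<in>states_above \<V> U s. n i) = of_nat (K U :: nat) * w U s"
    by metis
  \<comment> \<open>The index ((V, s), k) is the k-th copy of the assignment s with domain V. Copies
    are needed because a team is indexed by a set.\<close>
  define X :: "((nat set \<times> nat set) \<times> nat) team" where
    "X = (Sigma (Sigma \<V> Pow) (\<lambda>i. {..<n i}), \<lambda>((V, s), k) p. if p \<in> V then Some (p \<in> s) else None)"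
  have dom: "dom (snd X ((V, s), k)) = V" for V s k
    by (auto simp: X_def split: if_splits)
  have dom': "dom (snd X i) = fst (fst i)" for i
    using dom by (metis prod.collapse)
  have fstX: "fst X = Sigma (Sigma \<V> Pow) (\<lambda>i. {..<n i})"
    by (simp add: X_def)
  have holds: "holds_at X ((V, s), k) \<phi> = peval (\<lambda>p. p \<in> s \<inter> U) \<phi>"
    if "U \<subseteq> V" "pvars \<phi> \<subseteq> U" for U V s k \<phi>
    unfolding holds_at_def using that by (intro peval_cong) (auto simp: X_def)
  have "finite (Sigma \<V> Pow)"
    using fin by auto
  then have team: "quantum_team X"
    using fin ne unfolding quantum_team_def fstX by (auto simp: dom simp del: dom_eq_empty_conv)
  \<comment> \<open>The property Q is left open to serve twice: the trivial one yields the
    denominator, truth of \<phi> the numerator.\<close>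
  have card_eq: "rat_of_nat (card {i \<in> team_over X U. Q (snd (fst i) \<inter> U)}) =
      of_nat (K U) * (\<Sum>s\<in>{s \<in> Pow U. Q s}. w U s)" if U: "U \<in> \<V>" for U Q
  proof -
    let ?A = "\<lambda>s. Sigma (states_above \<V> U s) (\<lambda>i. {..<n i})"
    have "{i \<in> team_over X U. Q (snd (fst i) \<inter> U)} = (\<Union>s\<in>{s \<in> Pow U. Q s}. ?A s)"
      unfolding team_over_def fstX dom' by (auto simp: states_above_def)
    also have "card \<dots> = (\<Sum>s\<in>{s \<in> Pow U. Q s}. card (?A s))"
      using fin U finite_states_above[OF fin] by (intro card_UN_disjoint) (auto simp: states_above_def)
    also have "\<dots> = (\<Sum>s\<in>{s \<in> Pow U. Q s}. \<Sum>i\<in>states_above \<V> U s. n i)"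
      using finite_states_above[OF fin] by (simp add: card_SigmaI)
    finally have "rat_of_nat (card {i \<in> team_over X U. Q (snd (fst i) \<inter> U)}) =
        (\<Sum>s\<in>{s \<in> Pow U. Q s}. of_nat (\<Sum>i\<in>states_above \<V> U s. n i))"
      by (simp only: of_nat_sum)
    also have "\<dots> = (\<Sum>s\<in>{s \<in> Pow U. Q s}. of_nat (K U) * w U s)"
      using K(2)[OF U] by (intro sum.cong) auto
    finally show ?thesis
      by (simp add: sum_distrib_left)
  qed
  have card_over: "card (team_over X U) = K U" if "U \<in> \<V>" for U
    using card_eq[OF that, of "\<lambda>_. True"] total[OF that] by (simp flip: Pow_def)
  have "fam_le \<V> (team_supp X)"
    unfolding fam_le_def
  proof
    fix U assume U: "U \<in> \<V>"
    then have "team_over X U \<noteq> {}"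
      using card_over K(1) by fastforce
    then show "\<exists>U'\<in>team_supp X. U \<subseteq> U'"
      unfolding team_over_def team_supp_def by blast
  qed
  moreover have "team_prob X U \<phi> = of_rat (\<Sum>s\<in>{s \<in> Pow U. peval (\<lambda>p. p \<in> s) \<phi>}. w U s)"
    if U: "U \<in> \<V>" and \<phi>: "pvars \<phi> \<subseteq> U" for U \<phi>
  proof -
    let ?W = "\<Sum>s\<in>{s \<in> Pow U. peval (\<lambda>p. p \<in> s) \<phi>}. w U s"
    have "{i \<in> team_over X U. holds_at X i \<phi>} =
        {i \<in> team_over X U. peval (\<lambda>p. p \<in> snd (fst i) \<inter> U) \<phi>}"
      using holds[OF _ \<phi>] unfolding team_over_def dom' by auto
    then have "rat_of_nat (card {i \<in> team_over X U. holds_at X i \<phi>}) = of_nat (K U) * ?W"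
      using card_eq[OF U, of "\<lambda>s. peval (\<lambda>p. p \<in> s) \<phi>"] by simp
    then have "(of_rat (rat_of_nat (card {i \<in> team_over X U. holds_at X i \<phi>})) :: real) =
        of_rat (of_nat (K U) * ?W)"
      by (rule arg_cong)
    then have "real (card {i \<in> team_over X U. holds_at X i \<phi>}) = real (K U) * of_rat ?W"
      by (simp only: of_rat_mult of_rat_of_nat_eq)
    then show ?thesis
      using K(1)[OF U] card_over[OF U] by (simp add: team_prob_def)
  qed
  ultimately show ?thesis
    using that[of X] team by blast
qed

section \<open>Completeness\<close>

text \<open>A point can only be found for finitely many formulas at a time, so the consequences of \<open>T\<close> for
  the values of the terms have to be traced back to finitely many members of \<open>T\<close>.\<close>

definition forces :: "qfm set \<Rightarrow> ((pfm \<Rightarrow> nat set \<Rightarrow> rat) \<Rightarrow> bool) \<Rightarrow> bool" where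
  "forces T Q \<longleftrightarrow> (\<exists>\<Delta>. finite \<Delta> \<and> \<Delta> \<subseteq> T \<and> (\<forall>x. (\<forall>\<beta>\<in>\<Delta>. models x \<beta>) \<longrightarrow> Q x))"

lemma forces_mem: "\<beta> \<in> T \<Longrightarrow> forces T (\<lambda>x. models x \<beta>)"
  unfolding forces_def by (intro exI[of _ "{\<beta>}"]) auto

lemma forces_mono: "forces T Q \<Longrightarrow> (\<And>x. Q x \<Longrightarrow> R x) \<Longrightarrow> forces T R"
  unfolding forces_def by blast

lemma forces_all:
  assumes "finite I" "\<And>i. i \<in> I \<Longrightarrow> forces T (Q i)"
  shows "forces T (\<lambda>x. \<forall>i\<in>I. Q i x)"
proof -
  obtain \<Delta> where \<Delta>: "\<And>i. i \<in> I \<Longrightarrow> finite (\<Delta> i) \<and> \<Delta> i \<subseteq> T \<and> (\<forall>x. (\<forall>\<beta>\<in>\<Delta> i. models x \<beta>) \<longrightarrow> Q i x)"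
    using assms(2) unfolding forces_def by metis
  show ?thesis
    unfolding forces_def
    by (rule exI[of _ "\<Union>(\<Delta> ` I)"]) (use assms(1) \<Delta> in auto)
qed

lemma forces_conj:
  assumes "forces T Q" "forces T R"
  shows "forces T (\<lambda>x. Q x \<and> R x)"
proof -
  obtain \<Delta> \<Delta>' where "finite \<Delta>" "\<Delta> \<subseteq> T" "\<forall>x. (\<forall>\<beta>\<in>\<Delta>. models x \<beta>) \<longrightarrow> Q x"
    "finite \<Delta>'" "\<Delta>' \<subseteq> T" "\<forall>x. (\<forall>\<beta>\<in>\<Delta>'. models x \<beta>) \<longrightarrow> R x"
    using assms unfolding forces_def by blast
  then show ?thesis
    unfolding forces_def by (intro exI[of _ "\<Delta> \<union> \<Delta>'"]) blast
qed

lemma forces_mp: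
  assumes "forces T Q" "forces T R" "\<And>x. Q x \<Longrightarrow> R x \<Longrightarrow> S x"
  shows "forces T S"
  using forces_mono[OF forces_conj[OF assms(1,2)]] assms(3) by blast

text \<open>The point is taken for the witnesses of \<open>Q\<close> together with \<alpha>, so that
  it satisfies \<open>Q\<close> and also decides \<alpha> as \<open>T\<close> does, whether or not
  \<alpha> belongs to \<open>T\<close>.\<close>

lemma (in complete_theory) forces_realized:
  assumes "forces T Q" "\<alpha> \<in> wff \<V>"
  obtains x where "Q x" "\<alpha> \<in> T \<longleftrightarrow> models x \<alpha>"
proof -
  obtain \<Delta> where \<Delta>: "finite \<Delta>" "\<Delta> \<subseteq> T" "\<And>x. (\<forall>\<beta>\<in>\<Delta>. models x \<beta>) \<Longrightarrow> Q x"
    using assms(1) unfolding forces_def by blast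
  have "finite (insert \<alpha> \<Delta>)" "insert \<alpha> \<Delta> \<subseteq> wff \<V>"
    using \<Delta> assms(2) subset_wff by auto
  then obtain x :: "pfm \<Rightarrow> nat set \<Rightarrow> rat"
    where x: "\<And>\<beta>. \<beta> \<in> insert \<alpha> \<Delta> \<Longrightarrow> \<beta> \<in> T \<longleftrightarrow> models x \<beta>"
    by (rule finite_model) blast
  then have "Q x"
    using \<Delta>(2,3) by blast
  then show ?thesis
    using that x by blast
qed

text \<open>Literals are attached on the right of the formula built so far, which is the shape split
  by the axiom \<open>additive\<close>.\<close>

fun conj_lits :: "pfm \<Rightarrow> nat set \<Rightarrow> nat list \<Rightarrow> pfm" where
  "conj_lits \<phi> s [] = \<phi>"
| "conj_lits \<phi> s (p # ps) = conj_lits (PAnd \<phi> (if p \<in> s then PVar p else PNeg (PVar p))) s ps"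

lemma pvars_conj_lits [simp]: "pvars (conj_lits \<phi> s ps) = pvars \<phi> \<union> set ps"
  by (induction ps arbitrary: \<phi>) auto

lemma peval_conj_lits: "peval v (conj_lits \<phi> s ps) \<longleftrightarrow> peval v \<phi> \<and> (\<forall>p\<in>set ps. v p \<longleftrightarrow> p \<in> s)"
  by (induction ps arbitrary: \<phi>) auto

lemma conj_lits_cong: "s \<inter> set ps = s' \<inter> set ps \<Longrightarrow> conj_lits \<phi> s ps = conj_lits \<phi> s' ps"
proof (induction ps arbitrary: \<phi>)
  case (Cons p ps)
  have "p \<in> s \<longleftrightarrow> p \<in> s'" "s \<inter> set ps = s' \<inter> set ps"
    using Cons.prems by auto
  then show ?case
    using Cons.IH by simp
qed simp

text \<open>A substitute for the missing constant for truth, in the shape required by the axiom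
  \<open>total\<close>; \<open>Min\<close> merely selects some symbol of V.\<close>

definition vtrue :: "nat set \<Rightarrow> pfm" where
  "vtrue V = POr (PVar (Min V)) (PNeg (PVar (Min V)))"

definition state :: "nat set \<Rightarrow> nat set \<Rightarrow> pfm" where
  "state V s = conj_lits (vtrue V) s (sorted_list_of_set V)"

lemma peval_vtrue [simp]: "peval v (vtrue V)"
  by (simp add: vtrue_def)

lemma pvars_vtrue: "finite V \<Longrightarrow> V \<noteq> {} \<Longrightarrow> pvars (vtrue V) \<subseteq> V"
  by (simp add: vtrue_def)

lemma pvars_state: "finite V \<Longrightarrow> V \<noteq> {} \<Longrightarrow> pvars (state V s) = V"
  using pvars_vtrue by (auto simp: state_def)

lemma peval_state: "finite V \<Longrightarrow> peval v (state V s) \<longleftrightarrow> (\<forall>p\<in>V. v p \<longleftrightarrow> p \<in> s)"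
  by (simp add: state_def peval_conj_lits)

section \<open>Consequences of the probability and support laws for the values of terms\<close>

context complete_theory
begin

lemma forces_axiom: "qtl_axiom \<beta> \<Longrightarrow> \<beta> \<in> wff \<V> \<Longrightarrow> forces T (\<lambda>x. models x \<beta>)"
  by (simp add: forces_mem axiom_mem)

lemma EqualT_wff:
  "EqualT t t' \<in> wff \<V> \<longleftrightarrow> snd ` set t \<subseteq> terms_over \<V> \<and> snd ` set t' \<subseteq> terms_over \<V>"
  using Geq_wff[of t 0 \<V>] Geq_wff[of t' 0 \<V>] by (auto simp: wff_def simp del: Geq_wff)

lemma Equal_wff: "Equal t c \<in> wff \<V> \<longleftrightarrow> snd ` set t \<subseteq> terms_over \<V>"
  using Geq_wff[of t 0 \<V>] by (auto simp: wff_def simp del: Geq_wff)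

lemma forces_additive:
  assumes "(\<phi>, V) \<in> terms_over \<V>" "pvars \<psi> \<subseteq> V"
  shows "forces T (\<lambda>x. x (PAnd \<phi> \<psi>) V + x (PAnd \<phi> (PNeg \<psi>)) V = x \<phi> V)"
proof -
  have "forces T (\<lambda>x. models x
      (EqualT [(1, PAnd \<phi> \<psi>, V), (1, PAnd \<phi> (PNeg \<psi>), V)] [(1, \<phi>, V)]))"
    using assms by (intro forces_axiom qtl_axiom.additive) (auto simp: EqualT_wff terms_over_def)
  then show ?thesis
    by (rule forces_mono) simp
qed

lemma forces_equiv:
  assumes "(\<phi>, V) \<in> terms_over \<V>" "(\<psi>, V) \<in> terms_over \<V>" "pequiv \<phi> \<psi>"
  shows "forces T (\<lambda>x. x \<phi> V = x \<psi> V)"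
proof -
  have "forces T (\<lambda>x. models x (EqualT [(1, \<phi>, V)] [(1, \<psi>, V)]))"
    using assms by (intro forces_axiom qtl_axiom.equiv) (auto simp: EqualT_wff)
  then show ?thesis
    by (rule forces_mono) simp
qed

text \<open>An unsatisfiable \<phi> is equivalent both to its conjunction with itself and to its
  conjunction with its negation, so additivity says that its value is twice itself.\<close>

lemma forces_contradiction:
  assumes "(\<phi>, V) \<in> terms_over \<V>" "\<And>v. \<not> peval v \<phi>"
  shows "forces T (\<lambda>x. x \<phi> V = 0)"
proof (rule forces_mp)
  show "forces T (\<lambda>x. x (PAnd \<phi> \<phi>) V = x \<phi> V \<and> x (PAnd \<phi> (PNeg \<phi>)) V = x \<phi> V)"
    using assms by (intro forces_conj forces_equiv) (auto simp: terms_over_def pequiv_def)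
  show "forces T (\<lambda>x. x (PAnd \<phi> \<phi>) V + x (PAnd \<phi> (PNeg \<phi>)) V = x \<phi> V)"
    using assms by (intro forces_additive) (auto simp: terms_over_def)
qed simp

lemma forces_conj_lits_sum:
  assumes "(\<phi>, V) \<in> terms_over \<V>" "distinct ps" "set ps \<subseteq> V"
  shows "forces T (\<lambda>x. x \<phi> V = (\<Sum>s\<in>Pow (set ps). x (conj_lits \<phi> s ps) V))"
  using assms
proof (induction ps arbitrary: \<phi>)
  case Nil
  then show ?case
    using forces_equiv[of \<phi> V \<phi>] by (simp add: pequiv_def)
next
  case (Cons p ps)
  let ?pos = "PAnd \<phi> (PVar p)" and ?neg = "PAnd \<phi> (PNeg (PVar p))"
  have p: "p \<notin> set ps" "p \<in> V"
    using Cons.prems by auto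
  have split: "(\<Sum>s\<in>Pow (set (p # ps)). x (conj_lits \<phi> s (p # ps)) V) =
      (\<Sum>s\<in>Pow (set ps). x (conj_lits ?neg s ps) V) + (\<Sum>s\<in>Pow (set ps). x (conj_lits ?pos s ps) V)"
    for x :: "pfm \<Rightarrow> nat set \<Rightarrow> rat"
  proof -
    have "(\<Sum>s\<in>Pow (set (p # ps)). x (conj_lits \<phi> s (p # ps)) V) =
        (\<Sum>s\<in>Pow (set ps). x (conj_lits \<phi> s (p # ps)) V) +
        (\<Sum>s\<in>insert p ` Pow (set ps). x (conj_lits \<phi> s (p # ps)) V)"
      using p by (simp only: list.set Pow_insert) (intro sum.union_disjoint, auto)
    also have "(\<Sum>s\<in>Pow (set ps). x (conj_lits \<phi> s (p # ps)) V) =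
        (\<Sum>s\<in>Pow (set ps). x (conj_lits ?neg s ps) V)"
      using p by (intro sum.cong) auto
    also have "(\<Sum>s\<in>insert p ` Pow (set ps). x (conj_lits \<phi> s (p # ps)) V) =
        (\<Sum>s\<in>Pow (set ps). x (conj_lits \<phi> (insert p s) (p # ps)) V)"
      using p by (intro sum.reindex_cong[of "insert p"]) (auto simp: inj_on_def insert_eq_iff)
    also have "\<dots> = (\<Sum>s\<in>Pow (set ps). x (conj_lits ?pos s ps) V)"
      using p conj_lits_cong[of "insert p _" ps _ ?pos] by (intro sum.cong refl) auto
    finally show ?thesis .
  qed
  have "forces T (\<lambda>x. x ?pos V = (\<Sum>s\<in>Pow (set ps). x (conj_lits ?pos s ps) V) \<and>
      x ?neg V = (\<Sum>s\<in>Pow (set ps). x (conj_lits ?neg s ps) V))"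
    using Cons.prems by (intro forces_conj Cons.IH) (auto simp: terms_over_def)
  moreover have "forces T (\<lambda>x. x ?pos V + x ?neg V = x \<phi> V)"
    using Cons.prems p by (intro forces_additive) auto
  ultimately show ?case
    by (rule forces_mp) (simp only: split)
qed

text \<open>A complete assignment on V decides \<phi>: conjoined with \<phi>, its description is
  either equivalent to the state formula or contradictory and of value 0. So the values of all terms
  over V are determined by those of the states.\<close>

lemma forces_state_sum:
  assumes "(\<phi>, V) \<in> terms_over \<V>" "V \<noteq> {}"
  shows "forces T (\<lambda>x. x \<phi> V = (\<Sum>s\<in>{s \<in> Pow V. peval (\<lambda>p. p \<in> s) \<phi>}. x (state V s) V))"
proof -
  let ?ps = "sorted_list_of_set V"
  have V: "finite V" "pvars \<phi> \<subseteq> V" "\<And>\<psi>. pvars \<psi> \<subseteq> V \<Longrightarrow> (\<psi>, V) \<in> terms_over \<V>"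
    using assms(1) by (auto simp: terms_over_def)
  have sat: "peval v (conj_lits \<phi> s ?ps) \<longleftrightarrow> peval (\<lambda>p. p \<in> s) \<phi> \<and> (\<forall>p\<in>V. v p \<longleftrightarrow> p \<in> s)" for v s
  proof -
    have "peval v \<phi> = peval (\<lambda>p. p \<in> s) \<phi>" if "\<forall>p\<in>V. v p \<longleftrightarrow> p \<in> s"
      using that V(2) by (intro peval_cong) auto
    then show ?thesis
      using V(1) by (auto simp: peval_conj_lits)
  qed
  have conj_lits: "forces T (\<lambda>x. x (conj_lits \<phi> s ?ps) V = (if peval (\<lambda>p. p \<in> s) \<phi> then x (state V s) V else 0))"
    for s
  proof (cases "peval (\<lambda>p. p \<in> s) \<phi>")
    case True
    have "forces T (\<lambda>x. x (conj_lits \<phi> s ?ps) V = x (state V s) V)"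
      using True V sat assms(2)
      by (intro forces_equiv V(3)) (auto simp: pequiv_def peval_state pvars_state)
    with True show ?thesis
      by simp
  next
    case False
    then have "forces T (\<lambda>x. x (conj_lits \<phi> s ?ps) V = 0)"
      using V sat by (intro forces_contradiction V(3)) auto
    with False show ?thesis
      by simp
  qed
  have "forces T (\<lambda>x. \<forall>s\<in>Pow V.
      x (conj_lits \<phi> s ?ps) V = (if peval (\<lambda>p. p \<in> s) \<phi> then x (state V s) V else 0))"
    using V(1) conj_lits by (intro forces_all) auto
  moreover have "forces T (\<lambda>x. x \<phi> V = (\<Sum>s\<in>Pow (set ?ps). x (conj_lits \<phi> s ?ps) V))"
    using V by (intro forces_conj_lits_sum assms) auto
  ultimately show ?thesis
  proof (rule forces_mp)
    fix x :: "pfm \<Rightarrow> nat set \<Rightarrow> rat"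
    assume "\<forall>s\<in>Pow V. x (conj_lits \<phi> s ?ps) V = (if peval (\<lambda>p. p \<in> s) \<phi> then x (state V s) V else 0)"
      and "x \<phi> V = (\<Sum>s\<in>Pow (set ?ps). x (conj_lits \<phi> s ?ps) V)"
    then have "x \<phi> V = (\<Sum>s\<in>Pow V. if peval (\<lambda>p. p \<in> s) \<phi> then x (state V s) V else 0)"
      using V(1) by simp
    then show "x \<phi> V = (\<Sum>s\<in>{s \<in> Pow V. peval (\<lambda>p. p \<in> s) \<phi>}. x (state V s) V)"
      using V(1) by (simp only: sum.inter_filter finite_Pow_iff)
  qed
qed

lemma forces_nonneg:
  assumes "(\<phi>, V) \<in> terms_over \<V>"
  shows "forces T (\<lambda>x. 0 \<le> x \<phi> V)"
proof -
  have "forces T (\<lambda>x. models x (Geq [(1, \<phi>, V)] 0))"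
    using assms by (intro forces_axiom qtl_axiom.nonneg) auto
  then show ?thesis
    by (rule forces_mono) simp
qed

lemma forces_total:
  assumes "finite V" "V \<noteq> {}" "V \<in> \<V>"
  shows "forces T (\<lambda>x. (\<Sum>s\<in>Pow V. x (state V s) V) = 1)"
proof (rule forces_mp)
  have V: "(vtrue V, V) \<in> terms_over \<V>"
    using assms pvars_vtrue by (auto simp: terms_over_def)
  have "forces T (\<lambda>x. models x (Equal [(1, vtrue V, V)] 1))"
    unfolding vtrue_def using V
    by (intro forces_axiom qtl_axiom.total) (simp add: Equal_wff vtrue_def)
  then show "forces T (\<lambda>x. x (vtrue V) V = 1)"
    by (rule forces_mono) simp
  show "forces T (\<lambda>x. x (vtrue V) V =
      (\<Sum>s\<in>{s \<in> Pow V. peval (\<lambda>p. p \<in> s) (vtrue V)}. x (state V s) V))"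
    using V assms(2) by (rule forces_state_sum)
qed (simp flip: Pow_def)

text \<open>The state formula of U can also be read with support V, where its value is the sum over
  the states of V extending it. Change of support transports the value 0 from U to V, and a
  vanishing sum of nonnegative terms has only vanishing terms.\<close>

lemma forces_compat:
  assumes U: "finite U" "U \<noteq> {}" "U \<in> \<V>" and V: "finite V" "V \<in> \<V>" "U \<subseteq> V" and s: "s \<subseteq> V"
  shows "forces T (\<lambda>x. x (state U (s \<inter> U)) U = 0 \<longrightarrow> x (state V s) V = 0)"
proof -
  let ?u = "state U (s \<inter> U)"
  have ne: "V \<noteq> {}"
    using U V by auto
  have terms: "(?u, U) \<in> terms_over \<V>" "(?u, V) \<in> terms_over \<V>"
      "(state V s', V) \<in> terms_over \<V>" for s'
    using U V ne by (auto simp: terms_over_def pvars_state)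
  \<comment> \<open>The rule is used as an implication because the dependence must hold at a point,
    irrespective of whether its premise is in \<open>T\<close>.\<close>
  have "Imp (Equal [(1, ?u, U)] 0) (Equal [(1, ?u, V)] 0) \<in> T"
    using U V terms by (intro rule_Imp_mem qtl_rule.supp_zero) (auto simp: Equal_wff)
  then have lift: "forces T (\<lambda>x. x ?u U = 0 \<longrightarrow> x ?u V = 0)"
    by (rule forces_mono[OF forces_mem]) simp
  have "forces T (\<lambda>x. \<forall>s'\<in>Pow V. 0 \<le> x (state V s') V)"
    using V terms by (intro forces_all forces_nonneg) auto
  moreover have "forces T (\<lambda>x. x ?u V =
      (\<Sum>s'\<in>{s' \<in> Pow V. peval (\<lambda>p. p \<in> s') ?u}. x (state V s') V))"
    using terms ne by (intro forces_state_sum)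
  ultimately have "forces T (\<lambda>x. x ?u V = 0 \<longrightarrow> x (state V s) V = 0)"
  proof (rule forces_mp)
    fix x :: "pfm \<Rightarrow> nat set \<Rightarrow> rat"
    let ?S = "{s' \<in> Pow V. peval (\<lambda>p. p \<in> s') ?u}"
    assume x: "\<forall>s'\<in>Pow V. 0 \<le> x (state V s') V" "x ?u V = (\<Sum>s'\<in>?S. x (state V s') V)"
    have "s \<in> ?S" "finite ?S"
      using s V U by (auto simp: peval_state)
    then have "x (state V s) V \<le> x ?u V"
      unfolding x(2) using x(1) by (intro member_le_sum) auto
    then show "x ?u V = 0 \<longrightarrow> x (state V s) V = 0"
      using x(1) s by (metis PowI order_antisym)
  qed
  with lift show ?thesis
    by (rule forces_mp) simp
qed

end

section \<open>From a rational point to a real-valued team that refutes \<alpha>\<close>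

lemma lin_of_rat:
  assumes "\<And>\<phi> V. (\<phi>, V) \<in> snd ` set t \<Longrightarrow> y \<phi> V = of_rat (x \<phi> V)"
  shows "lin y t = (of_rat (lin x t) :: real)"
  using assms by (induction t) (auto simp: of_rat_add of_rat_mult)

lemma models_of_rat:
  assumes "\<forall>(\<phi>, V)\<in>\<Union>(t, c)\<in>atoms \<beta>. snd ` set t. y \<phi> V = (of_rat (x \<phi> V) :: real)"
  shows "models y \<beta> \<longleftrightarrow> models x \<beta>"
  using assms
proof (induction \<beta>)
  case (Geq t c)
  then have "lin y t = of_rat (lin x t)"
    by (intro lin_of_rat) auto
  then have "models y (Geq t c) \<longleftrightarrow> (of_rat (of_int c) :: real) \<le> of_rat (lin x t)"
    by simp
  then show ?case
    by (simp only: of_rat_less_eq models.simps)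
qed (simp_all add: ball_Un)

lemma supp_eq_atoms: "supp \<beta> = (\<Union>(t, c)\<in>atoms \<beta>. snd ` snd ` set t)"
  by (induction \<beta>) (auto simp: image_image split_beta)

lemma valid_imp_provable:
  assumes wf: "qtl_formula \<alpha>" and valid: "valid \<alpha>"
  shows "provable \<alpha>"
proof (rule theorems_provable, rule ccontr)
  let ?\<V> = "supp \<alpha>"
  have \<alpha>: "\<alpha> \<in> wff ?\<V>"
    using wf by (auto simp: wff_def fam_le_def)
  assume "\<alpha> \<notin> theorems ?\<V>"
  then obtain T where "complete_theory ?\<V> T" and notin: "\<alpha> \<notin> T"
    using lindenbaum[OF \<alpha>] by blast
  then interpret complete_theory ?\<V> T
    by simp
  have fin: "finite ?\<V>" "\<And>V. V \<in> ?\<V> \<Longrightarrow> finite V" and ne: "\<And>V. V \<in> ?\<V> \<Longrightarrow> V \<noteq> {}"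
    using finite_supp supp_members[OF wf] by auto
  define Y where "Y = (\<Union>(t, c)\<in>atoms \<alpha>. snd ` set t)"
  have finY: "finite Y"
    unfolding Y_def using finite_atoms by (intro finite_UN_I) auto
  have Y: "(\<phi>, V) \<in> terms_over ?\<V>" "V \<in> ?\<V>" if "(\<phi>, V) \<in> Y" for \<phi> V
  proof -
    show "(\<phi>, V) \<in> terms_over ?\<V>"
      using that \<alpha> unfolding wff_iff_atoms Y_def by blast
    show "V \<in> ?\<V>"
      using that unfolding supp_eq_atoms Y_def by force
  qed
  \<comment> \<open>This reduces the terms of \<alpha> to the weights of states. The three facts
    that follow are the hypotheses of \<open>weights_realized\<close> for these weights.\<close>
  have "forces T (\<lambda>x. \<forall>(\<phi>, V)\<in>Y.
      x \<phi> V = (\<Sum>s\<in>{s \<in> Pow V. peval (\<lambda>p. p \<in> s) \<phi>}. x (state V s) V))"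
    unfolding split_beta using Y ne finY by (intro forces_all forces_state_sum) (auto simp: split_beta)
  moreover have "forces T (\<lambda>x. \<forall>V\<in>?\<V>. (\<Sum>s\<in>Pow V. x (state V s) V) = 1)"
    using fin ne by (intro forces_all forces_total) auto
  moreover have "forces T (\<lambda>x. \<forall>V\<in>?\<V>. \<forall>s\<in>Pow V. 0 \<le> x (state V s) V)"
    using fin ne by (intro forces_all forces_nonneg) (auto simp: terms_over_def pvars_state)
  moreover have "forces T (\<lambda>x. \<forall>U\<in>?\<V>. \<forall>V\<in>{V \<in> ?\<V>. U \<subseteq> V}. \<forall>s\<in>Pow V.
      x (state U (s \<inter> U)) U = 0 \<longrightarrow> x (state V s) V = 0)"
    using fin ne by (intro forces_all forces_compat) auto
  ultimately have "forces T (\<lambda>x.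
      (\<forall>(\<phi>, V)\<in>Y. x \<phi> V = (\<Sum>s\<in>{s \<in> Pow V. peval (\<lambda>p. p \<in> s) \<phi>}. x (state V s) V)) \<and>
      (\<forall>V\<in>?\<V>. (\<Sum>s\<in>Pow V. x (state V s) V) = 1) \<and>
      (\<forall>V\<in>?\<V>. \<forall>s\<in>Pow V. 0 \<le> x (state V s) V) \<and>
      (\<forall>U\<in>?\<V>. \<forall>V\<in>{V \<in> ?\<V>. U \<subseteq> V}. \<forall>s\<in>Pow V.
        x (state U (s \<inter> U)) U = 0 \<longrightarrow> x (state V s) V = 0))" (is "forces T ?Q")
    by (intro forces_conj)
  then obtain x :: "pfm \<Rightarrow> nat set \<Rightarrow> rat" where Q: "?Q x" and x\<alpha>: "\<alpha> \<in> T \<longleftrightarrow> models x \<alpha>"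
    using \<alpha> by (rule forces_realized)
  note x = conjunct1[OF Q] conjunct1[OF conjunct2[OF Q]]
    conjunct1[OF conjunct2[OF conjunct2[OF Q]]] conjunct2[OF conjunct2[OF conjunct2[OF Q]]]
  obtain X :: "((nat set \<times> nat set) \<times> nat) team" where X: "quantum_team X" "fam_le ?\<V> (team_supp X)"
    "\<And>U \<phi>. U \<in> ?\<V> \<Longrightarrow> pvars \<phi> \<subseteq> U \<Longrightarrow>
      team_prob X U \<phi> = of_rat (\<Sum>s\<in>{s \<in> Pow U. peval (\<lambda>p. p \<in> s) \<phi>}. x (state U s) U)"
  proof (rule weights_realized[of ?\<V> "\<lambda>V s. x (state V s) V"])
    show "{} \<notin> ?\<V>"
      using ne by blast
  qed (use fin x in auto)
  \<comment> \<open>Team and point need to agree only on the terms occurring in \<alpha>, since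
    nothing else affects its truth.\<close>
  have "team_prob X V \<phi> = of_rat (x \<phi> V)" if "(\<phi>, V) \<in> Y" for \<phi> V
  proof -
    have "pvars \<phi> \<subseteq> V"
      using Y[OF that] by (auto simp: terms_over_def)
    then show ?thesis
      using X(3)[OF Y(2)[OF that]] x(1) that by auto
  qed
  then have "sat X \<alpha> \<longleftrightarrow> models x \<alpha>"
    unfolding sat_eq_models Y_def by (intro models_of_rat) blast
  \<comment> \<open>The team is indexed by copies of states, whereas \<open>valid\<close> speaks of
    natural numbers; \<open>valid_imp_sat\<close> bridges the two.\<close>
  moreover have "sat X \<alpha>"
    using valid X by (intro valid_imp_sat)
  ultimately show False
    using x\<alpha> notin by simp
qed

theorem theorem7p15:
  fixes \<alpha> :: qfm
  assumes "qtl_formula \<alpha>"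
  shows "provable \<alpha> \<longleftrightarrow> valid \<alpha>"
  using provable_imp_valid valid_imp_provable[OF assms] by blast

end
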